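(* Let $\mathcal{H}$ be an infinite-dimensional complex reproducing kernel Hilbert space of functions on a set $X$, with reproducing kernels $k_w$ ($w\in X$). Take two disjoint finite sets $\mathbf{a}=\{a_1,\dots,a_m\}$ and $\mathbf{b}=\{b_1,\dots,b_k\}$ of points of $X$. Let $\mathcal{Z}_{\mathbf{a}}=\{f\in\mathcal{H}: f(a_j)=0,\ 1\le j\le m\}$ and $\mathcal{Z}_{\mathbf{b}}=\{f\in\mathcal{H}: f(b_i)=0,\ 1\le i\le k\}$. Then the following hold: (i) There exists a geodesic in $\mathrm{Gr}(\mathcal{H})$ joining $\mathcal{Z}_{\mathbf{a}}$ and $\mathcal{Z}_{\mathbf{b}}$ if and only if $m=k$. (ii) If $k=m$, there is a unique geodesic joining $\mathcal{Z}_{\mathbf{a}}$ and $\mathcal{Z}_{\mathbf{b}}$ if and only if $$\det\left((k_{b_i}(a_j))_{1\le i,j\le k}\right)\neq 0.$$ Otherwise, there are infinitely many geodesics joining these subspaces.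
   Context: The kernel $k_w\in\mathcal{H}$ is defined by $f(w)=\langle f,k_w\rangle$ for all $f\in\mathcal{H}$. $\mathrm{Gr}(\mathcal{H})$ is the Grassmann manifold of all closed subspaces of $\mathcal{H}$, identified with the set of orthogonal projections of $\mathcal{H}$. A geodesic joining closed subspaces $\mathcal{S}$ and $\mathcal{T}$ is a curve $\delta(t)=e^{itX}\mathcal{S}$, $t\in[0,1]$, with $X=X^*$ a bounded operator which is co-diagonal with respect to $\mathcal{S}$ (that is, $X\mathcal{S}\subset\mathcal{S}^\perp$ and $X\mathcal{S}^\perp\subset\mathcal{S}$) and $e^{iX}\mathcal{S}=\mathcal{T}$. The length of a curve of projections $P(t)$ is $\int\|\dot P(t)\|\,dt$, with the operator norm. Existence of a geodesic joining two subspaces is equivalent to existence of one of minimal length (with $\|X\|\le\pi/2$), and uniqueness of geodesics refers to geodesics of minimal length, up to reparametrization.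
   Formalization: Added: the kernels k_{a_1},…,k_{a_m} are linearly independent, and so are k_{b_1},…,k_{b_k}; without this the claim fails, e.g. for even functions with a={1/2,−1/2}, b={1/3}, where m≠k but both zero spaces have codimension 1. *)

theory Defs
  imports "HOL-Analysis.Analysis" "Jordan_Normal_Form.Determinant"
begin

text \<open>
  A complex inner product space is a real inner product space whose scalar multiplication extends
  to the complex numbers and whose inner product is the real part of a complex one. The complex
  inner product is linear in its first argument.
\<close>

class complex_inner = real_inner +
  fixes scaleC :: "complex \<Rightarrow> 'a \<Rightarrow> 'a" (infixr \<open>*\<^sub>C\<close> 75)
    and cinner :: "'a \<Rightarrow> 'a \<Rightarrow> complex"
  assumes scaleC_add_right: "c *\<^sub>C (x + y) = c *\<^sub>C x + c *\<^sub>C y"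
    and scaleC_add_left: "(c + d) *\<^sub>C x = c *\<^sub>C x + d *\<^sub>C x"
    and scaleC_scaleC: "c *\<^sub>C d *\<^sub>C x = (c * d) *\<^sub>C x"
    and scaleR_scaleC: "scaleR r x = complex_of_real r *\<^sub>C x"
    and cinner_commute: "cinner x y = cnj (cinner y x)"
    and cinner_add_left: "cinner (x + y) z = cinner x z + cinner y z"
    and cinner_scaleC_left: "cinner (c *\<^sub>C x) y = c * cinner x y"
    and inner_eq_Re_cinner: "inner x y = Re (cinner x y)"

class chilbert_space = complex_inner + banach

global_interpretation complex_vector:
  vector_space "scaleC :: complex \<Rightarrow> 'a \<Rightarrow> 'a::complex_inner"
proof
  fix x :: 'a
  show "1 *\<^sub>C x = x"
    using scaleR_scaleC[of 1 x] by simp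
qed (simp_all add: scaleC_add_right scaleC_add_left scaleC_scaleC)

definition infinite_cdim :: "'a::complex_inner itself \<Rightarrow> bool" where
  "infinite_cdim _ \<longleftrightarrow> (\<nexists>B::'a set. finite B \<and> complex_vector.span B = UNIV)"

text \<open>
  The elements of a Hilbert space are regarded as functions on the type \<open>'x\<close> by means of the
  injective map \<open>ev\<close>, where \<open>ev f w\<close> is the value \<open>f(w)\<close>. The reproducing property forces \<open>ev\<close> to
  be complex linear (so the vector space operations are the pointwise ones) and makes the point
  evaluations continuous; it also determines \<open>K\<close>.
\<close>

definition rkhs :: "('h::chilbert_space \<Rightarrow> 'x \<Rightarrow> complex) \<Rightarrow> ('x \<Rightarrow> 'h) \<Rightarrow> bool" where
  "rkhs ev K \<longleftrightarrow> inj ev \<and> (\<forall>f w. ev f w = cinner f (K w))"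

definition zero_subspace :: "('h \<Rightarrow> 'x \<Rightarrow> complex) \<Rightarrow> 'x set \<Rightarrow> 'h set" where
  "zero_subspace ev A = {f. \<forall>w\<in>A. ev f w = 0}"

definition Gr :: "'h::chilbert_space set set" where
  "Gr = {S. closed S \<and> complex_vector.subspace S}"

definition orth_compl :: "'h::complex_inner set \<Rightarrow> 'h set" where
  "orth_compl S = {x. \<forall>y\<in>S. cinner x y = 0}"

definition orth_proj :: "'h::complex_inner set \<Rightarrow> 'h \<Rightarrow> 'h" where
  "orth_proj S x = (THE y. y \<in> S \<and> x - y \<in> orth_compl S)"

definition bounded_clinear :: "('h::complex_inner \<Rightarrow> 'h) \<Rightarrow> bool" where
  "bounded_clinear A \<longleftrightarrow> bounded_linear A \<and> (\<forall>c x. A (c *\<^sub>C x) = c *\<^sub>C A x)"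

definition selfadjoint :: "('h::complex_inner \<Rightarrow> 'h) \<Rightarrow> bool" where
  "selfadjoint A \<longleftrightarrow> (\<forall>x y. cinner (A x) y = cinner x (A y))"

definition codiagonal :: "'h::complex_inner set \<Rightarrow> ('h \<Rightarrow> 'h) \<Rightarrow> bool" where
  "codiagonal S A \<longleftrightarrow> A ` S \<subseteq> orth_compl S \<and> A ` orth_compl S \<subseteq> S"

definition op_exp :: "('h::chilbert_space \<Rightarrow> 'h) \<Rightarrow> 'h \<Rightarrow> 'h" where
  "op_exp A x = (\<Sum>n. (A ^^ n) x /\<^sub>R fact n)"

text \<open>Curves are functions on the reals, of which only the values on \<open>{0..1}\<close> matter.\<close>

definition geodesic_joining ::
    "'h::chilbert_space set \<Rightarrow> 'h set \<Rightarrow> (real \<Rightarrow> 'h set) \<Rightarrow> bool" where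
  "geodesic_joining S T \<delta> \<longleftrightarrow> S \<in> Gr \<and> T \<in> Gr \<and>
     (\<exists>A. bounded_clinear A \<and> selfadjoint A \<and> codiagonal S A \<and>
          (\<forall>t\<in>{0..1}. \<delta> t = op_exp (\<lambda>x. (\<i> * complex_of_real t) *\<^sub>C A x) ` S) \<and>
          op_exp (\<lambda>x. \<i> *\<^sub>C A x) ` S = T)"

text \<open>
  The curve of orthogonal projections, as a curve in the space of bounded operators with the
  operator norm.
\<close>

definition proj_curve ::
    "(real \<Rightarrow> 'h::chilbert_space set) \<Rightarrow> real \<Rightarrow> ('h \<Rightarrow>\<^sub>L 'h)" where
  "proj_curve \<gamma> t = Blinfun (orth_proj (\<gamma> t))"

definition speed :: "(real \<Rightarrow> 'h::chilbert_space set) \<Rightarrow> real \<Rightarrow> real" where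
  "speed \<gamma> t = norm (vector_derivative (proj_curve \<gamma>) (at t))"

definition curve_length :: "(real \<Rightarrow> 'h::chilbert_space set) \<Rightarrow> real" where
  "curve_length \<gamma> = integral {0..1} (speed \<gamma>)"

text \<open>
  The library's piecewise \<open>C\<^sup>1\<close> condition does not bound the derivative near the break points, so
  finiteness of the length is required separately.
\<close>

definition Gr_curve_joining ::
    "'h::chilbert_space set \<Rightarrow> 'h set \<Rightarrow> (real \<Rightarrow> 'h set) \<Rightarrow> bool" where
  "Gr_curve_joining S T \<gamma> \<longleftrightarrow> (\<forall>t\<in>{0..1}. \<gamma> t \<in> Gr) \<and> \<gamma> 0 = S \<and> \<gamma> 1 = T \<and>
     proj_curve \<gamma> piecewise_C1_differentiable_on {0..1} \<and> speed \<gamma> integrable_on {0..1}"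

definition minimal_geodesics ::
    "'h::chilbert_space set \<Rightarrow> 'h set \<Rightarrow> (real \<Rightarrow> 'h set) set" where
  "minimal_geodesics S T = {\<delta>. geodesic_joining S T \<delta> \<and>
     (\<forall>\<gamma>. Gr_curve_joining S T \<gamma> \<longrightarrow> curve_length \<delta> \<le> curve_length \<gamma>)}"

text \<open>Strictly increasing surjections of \<open>{0..1}\<close> are its orientation preserving homeomorphisms.\<close>

definition reparam :: "((real \<Rightarrow> 'h set) \<times> (real \<Rightarrow> 'h set)) set" where
  "reparam = {(\<gamma>, \<delta>). \<exists>\<phi>::real \<Rightarrow> real. strict_mono_on {0..1} \<phi> \<and> \<phi> ` {0..1} = {0..1} \<and>
     (\<forall>t\<in>{0..1}. \<delta> t = \<gamma> (\<phi> t))}"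

definition unique_geodesic :: "'h::chilbert_space set \<Rightarrow> 'h set \<Rightarrow> bool" where
  "unique_geodesic S T \<longleftrightarrow> (\<exists>!c. c \<in> minimal_geodesics S T // reparam)"

definition infinitely_many_geodesics :: "'h::chilbert_space set \<Rightarrow> 'h set \<Rightarrow> bool" where
  "infinitely_many_geodesics S T \<longleftrightarrow> infinite (minimal_geodesics S T // reparam)"

end

theory Submission
  imports Defs
begin

text \<open>
  The orthogonal complements of the two zero subspaces are the spans \<open>N\<close>, \<open>M\<close> of finitely many
  kernels. Diagonalizing \<open>X\<^sup>2\<close> on \<open>N\<close> shows that every geodesic rotates an orthonormal basis \<open>e i\<close>
  of \<open>N\<close> towards orthogonal vectors \<open>g i\<close> with constant angular velocities \<open>l i \<ge> 0\<close>, so it joins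
  spaces of equal codimension and has length \<open>max l i\<close>. If the dimensions of \<open>N\<close> and \<open>M\<close> agree,
  their principal vectors yield a geodesic with \<open>l i \<le> pi / 2\<close>; it is minimal because the angle
  between a fixed unit vector and a moving subspace changes at most as fast as the subspace. If all
  principal angles are less than \<open>pi / 2\<close>, they and the vectors \<open>g i\<close> can be recovered from the
  projection onto \<open>M\<close>. A right angle, which means that \<open>N\<close> meets the complement of \<open>M\<close>, that is,
  \<open>det G = 0\<close>, leaves the phase of \<open>g i\<close> free.
\<close>

section \<open>Orthonormal bases in complex inner product spaces\<close>

text \<open>All work takes place on the finite-dimensional complements \<open>N\<close>,
  \<open>M\<close> of the two zero subspaces: a self-adjoint co-diagonal operator is determined by
  its values on \<open>N\<close>. Bases adapted to an operator come from maximizing a norm over a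
  unit sphere and splitting off the maximizer; this one device yields both the singular values of
  \<open>X\<close> on \<open>N\<close> and the principal vectors of two subspaces. Some obstacles
  shape the rest. A geodesic may turn by angles beyond pi / 2; for a minimal one this is excluded by
  comparison with the rotation through the principal angles. Repeated angles make the frame
  \<open>e\<close>, \<open>g\<close> ambiguous, so uniqueness is proved for the operator and not for
  the frame. Geodesics count up to reparametrization, so curves for different phases must differ as
  sets of subspaces; a midpoint that the other curve never meets separates them. The length estimate
  uses the doubled angle because its cosine is an affine function of \<open>inner (P x) x\<close>,
  which is differentiable wherever the curve of projections is.\<close>

lemma cinner_add_right: "cinner x (y + z) = cinner x y + cinner x z"
  by (metis cinner_add_left cinner_commute complex_cnj_add)

lemma cinner_scaleC_right: "cinner x (c *\<^sub>C y) = cnj c * cinner x y"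
  by (metis cinner_commute cinner_scaleC_left complex_cnj_mult)

lemma cinner_zero_left [simp]: "cinner 0 x = 0"
  using cinner_add_left[of 0 0 x] by simp

lemma cinner_zero_right [simp]: "cinner x 0 = 0"
  using cinner_add_right[of x 0 0] by simp

lemma cinner_eq_0_commute: "cinner x y = 0 \<longleftrightarrow> cinner y x = 0"
  by (metis cinner_commute complex_cnj_zero_iff)

lemma cinner_minus_left: "cinner (- x) y = - cinner x y"
  using cinner_add_left[of x "- x" y] by (simp add: eq_neg_iff_add_eq_0 add.commute)

lemma cinner_minus_right: "cinner x (- y) = - cinner x y"
  using cinner_add_right[of x y "- y"] by (simp add: eq_neg_iff_add_eq_0 add.commute)

lemma cinner_diff_left: "cinner (x - y) z = cinner x z - cinner y z"
  using cinner_add_left[of x "- y" z] by (simp add: cinner_minus_left)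

lemma cinner_diff_right: "cinner x (y - z) = cinner x y - cinner x z"
  using cinner_add_right[of x y "- z"] by (simp add: cinner_minus_right)

lemma cinner_scaleR_left: "cinner (r *\<^sub>R x) y = complex_of_real r * cinner x y"
  by (simp add: scaleR_scaleC cinner_scaleC_left)

lemma cinner_scaleR_right: "cinner x (r *\<^sub>R y) = complex_of_real r * cinner x y"
  by (simp add: scaleR_scaleC cinner_scaleC_right)

lemma cinner_sum_left: "cinner (sum f I) y = (\<Sum>i\<in>I. cinner (f i) y)"
  by (induction I rule: infinite_finite_induct) (simp_all add: cinner_add_left)

lemma cinner_sum_right: "cinner x (sum f I) = (\<Sum>i\<in>I. cinner x (f i))"
  by (induction I rule: infinite_finite_induct) (simp_all add: cinner_add_right)

lemmas cinner_simps = cinner_add_left cinner_add_right cinner_diff_left cinner_diff_right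
  cinner_minus_left cinner_minus_right cinner_scaleC_left cinner_scaleC_right
  cinner_scaleR_left cinner_scaleR_right cinner_sum_left cinner_sum_right

lemma cinner_self: "cinner x x = complex_of_real ((norm x)\<^sup>2)"
proof -
  have "Im (cinner x x) = 0"
    using cinner_commute[of x x] by (metis Reals_cnj_iff complex_is_Real_iff)
  moreover have "Re (cinner x x) = (norm x)\<^sup>2"
    by (simp add: power2_norm_eq_inner inner_eq_Re_cinner)
  ultimately show ?thesis
    by (simp add: complex_eq_iff)
qed

lemma cinner_self_eq_1_iff: "cinner x x = 1 \<longleftrightarrow> norm x = 1"
  unfolding cinner_self of_real_eq_1_iff by (simp add: power2_eq_1_iff) (smt (verit) norm_ge_zero)

lemma cinner_self_eq_0_iff [simp]: "cinner x x = 0 \<longleftrightarrow> x = 0"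
  unfolding cinner_self by simp

lemma norm_scaleC [simp]: "norm (c *\<^sub>C x) = norm c * norm x"
proof -
  have "complex_of_real ((norm (c *\<^sub>C x))\<^sup>2) = complex_of_real ((norm c * norm x)\<^sup>2)"
    unfolding cinner_self[symmetric] cinner_simps
    by (simp add: cinner_self power_mult_distrib complex_norm_square mult_ac del: of_real_power)
  then have "(norm (c *\<^sub>C x))\<^sup>2 = (norm c * norm x)\<^sup>2"
    using of_real_eq_iff by blast
  then show ?thesis
    by (simp add: power2_eq_iff_nonneg)
qed

text \<open>The unimodular factor \<open>c\<close> turns the complex inner product into a
  nonnegative real number, to which the real Cauchy-Schwarz inequality applies.\<close>

lemma norm_cinner_le: "norm (cinner x y) \<le> norm x * norm y"
proof (cases "cinner x y = 0")
  case False
  define c where "c = cnj (cinner x y) / norm (cinner x y)"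
  have c: "norm c = 1" and "c * cinner x y = norm (cinner x y)"
    using False by (simp_all add: c_def norm_divide complex_norm_square[symmetric] power2_eq_square
        mult.commute[of "cnj _"])
  then have "norm (cinner x y) = inner (c *\<^sub>C x) y"
    by (simp add: inner_eq_Re_cinner cinner_scaleC_left)
  also have "\<dots> \<le> norm (c *\<^sub>C x) * norm y"
    by (rule norm_cauchy_schwarz)
  finally show ?thesis
    using c by simp
qed simp

lemma bounded_linear_cinner_left: "bounded_linear (\<lambda>x. cinner x y)"
  by (rule bounded_linear_intro[of _ "norm y"])
    (simp_all add: cinner_simps norm_cinner_le scaleR_conv_of_real)

lemma continuous_on_cinner_left [continuous_intros]:
  "continuous_on S f \<Longrightarrow> continuous_on S (\<lambda>t. cinner (f t) y)"
  by (rule bounded_linear.continuous_on[OF bounded_linear_cinner_left])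

lemma scaleC_scaleR: "c *\<^sub>C r *\<^sub>R x = r *\<^sub>R c *\<^sub>C x"
  by (simp add: scaleR_scaleC mult.commute)

lemma bounded_bilinear_scaleC: "bounded_bilinear (\<lambda>(c::complex) (x::'h::complex_inner). c *\<^sub>C x)"
  by standard (auto simp: scaleC_add_left scaleC_add_right scaleC_scaleR scaleR_conv_of_real
      scaleC_scaleC scaleR_scaleC mult.commute intro!: exI[of _ 1])

section \<open>Orthogonal complements\<close>

lemma subspace_orth_compl: "complex_vector.subspace (orth_compl S)"
  unfolding orth_compl_def complex_vector.subspace_def by (auto simp: cinner_simps)

lemma closed_orth_compl: "closed (orth_compl S)"
proof -
  have "orth_compl S = (\<Inter>y\<in>S. {x. cinner x y = 0})"
    unfolding orth_compl_def by auto
  moreover have "closed {x. cinner x y = 0}" for y :: 'a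
    by (intro closed_Collect_eq continuous_intros)
  ultimately show ?thesis
    by auto
qed

lemma orth_compl_span: "orth_compl (complex_vector.span S) = orth_compl S"
proof
  show "orth_compl S \<subseteq> orth_compl (complex_vector.span S)"
  proof
    fix x assume x: "x \<in> orth_compl S"
    have "complex_vector.subspace {y. cinner x y = 0}"
      unfolding complex_vector.subspace_def by (auto simp: cinner_simps)
    then have "complex_vector.span S \<subseteq> {y. cinner x y = 0}"
      using x by (intro complex_vector.span_minimal) (auto simp: orth_compl_def)
    then show "x \<in> orth_compl (complex_vector.span S)"
      by (auto simp: orth_compl_def)
  qed
qed (auto simp: orth_compl_def complex_vector.span_base)

lemma orth_compl_in_Gr: "orth_compl S \<in> Gr"
  by (simp add: Gr_def closed_orth_compl subspace_orth_compl)

section \<open>Finite orthonormal bases and the projections that they define\<close>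

definition fproj :: "nat \<Rightarrow> (nat \<Rightarrow> 'h::complex_inner) \<Rightarrow> 'h \<Rightarrow> 'h" where
  "fproj m e x = (\<Sum>i<m. cinner x (e i) *\<^sub>C e i)"

definition onb :: "nat \<Rightarrow> (nat \<Rightarrow> 'h::complex_inner) \<Rightarrow> 'h set \<Rightarrow> bool" where
  "onb m e N \<longleftrightarrow> (\<forall>i<m. \<forall>j<m. cinner (e i) (e j) = of_bool (i = j)) \<and>
     complex_vector.span (e ` {..<m}) = N"

lemma onb_cinner: "onb m e N \<Longrightarrow> i < m \<Longrightarrow> j < m \<Longrightarrow> cinner (e i) (e j) = of_bool (i = j)"
  by (simp add: onb_def)

lemma onb_mem: "onb m e N \<Longrightarrow> i < m \<Longrightarrow> e i \<in> N"
  by (auto simp: onb_def intro: complex_vector.span_base)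

lemma onb_subspace: "onb m e N \<Longrightarrow> complex_vector.subspace N"
  by (auto simp: onb_def)

lemma onb_norm: "onb m e N \<Longrightarrow> i < m \<Longrightarrow> norm (e i) = 1"
  using onb_cinner[of m e N i i] by (simp add: cinner_self_eq_1_iff)

lemma onb_orth_compl: "onb m e N \<Longrightarrow> orth_compl N = {x. \<forall>i<m. cinner x (e i) = 0}"
  unfolding onb_def using orth_compl_span[of "e ` {..<m}"] by (auto simp: orth_compl_def)

lemma fproj_mem: "onb m e N \<Longrightarrow> fproj m e x \<in> N"
  unfolding fproj_def
  by (intro complex_vector.subspace_sum complex_vector.subspace_scale)
    (auto intro: onb_mem onb_subspace)

lemma cinner_fproj:
  assumes "onb m e N" "j < m"
  shows "cinner (fproj m e x) (e j) = cinner x (e j)"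
proof -
  have "cinner (fproj m e x) (e j) = (\<Sum>i<m. cinner x (e i) * of_bool (i = j))"
    unfolding fproj_def cinner_simps using assms by (intro sum.cong) (auto simp: onb_cinner)
  then show ?thesis
    using assms(2) by (simp add: of_bool_def if_distrib[of "(*) _"] cong: if_cong)
qed

lemma fproj_orth: "onb m e N \<Longrightarrow> x - fproj m e x \<in> orth_compl N"
  by (simp add: onb_orth_compl cinner_diff_left cinner_fproj)

lemma orth_compl_mem_zero: "x \<in> S \<Longrightarrow> x \<in> orth_compl S \<Longrightarrow> x = 0"
  unfolding orth_compl_def using cinner_self_eq_0_iff by blast

lemma fproj_id:
  assumes "onb m e N" "x \<in> N"
  shows "fproj m e x = x"
proof -
  have "x - fproj m e x \<in> N"
    by (rule complex_vector.subspace_diff[OF onb_subspace[OF assms(1)] assms(2) fproj_mem[OF assms(1)]])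
  then show ?thesis
    using orth_compl_mem_zero[OF _ fproj_orth[OF assms(1), of x]] by simp
qed

text \<open>For \<open>x\<close> in the double complement, the residue of its projection onto
  \<open>N\<close> is orthogonal to \<open>x\<close> and to \<open>N\<close>, hence to
  itself.\<close>

lemma onb_orth_compl_orth_compl:
  assumes "onb m e N"
  shows "orth_compl (orth_compl N) = N"
proof
  show "orth_compl (orth_compl N) \<subseteq> N"
  proof
    fix x assume x: "x \<in> orth_compl (orth_compl N)"
    have "cinner (x - fproj m e x) (x - fproj m e x) = 0"
    proof -
      have "cinner x (x - fproj m e x) = 0" "cinner (x - fproj m e x) (fproj m e x) = 0"
        using x fproj_orth[OF assms, of x] fproj_mem[OF assms, of x] by (auto simp: orth_compl_def)
      then show ?thesis
        by (metis cinner_diff_right cinner_eq_0_commute diff_self)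
    qed
    then show "x \<in> N"
      using fproj_mem[OF assms, of x] by simp
  qed
  show "N \<subseteq> orth_compl (orth_compl N)"
    unfolding orth_compl_def using cinner_eq_0_commute by blast
qed

lemma onb_independent:
  assumes "onb m e N"
  shows "complex_vector.independent (e ` {..<m})" "card (e ` {..<m}) = m"
proof -
  have inj: "inj_on e {..<m}"
  proof (rule inj_onI)
    fix i j assume "i \<in> {..<m}" "j \<in> {..<m}" "e i = e j"
    then show "i = j"
      using onb_cinner[OF assms, of i j] onb_cinner[OF assms, of j j] by (auto split: if_splits)
  qed
  then show "card (e ` {..<m}) = m"
    by (simp add: card_image)
  show "complex_vector.independent (e ` {..<m})"
  proof (rule complex_vector.independent_if_scalars_zero)
    fix f x assume f: "(\<Sum>x\<in>e ` {..<m}. f x *\<^sub>C x) = 0" and "x \<in> e ` {..<m}"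
    then obtain j where j: "j < m" "x = e j"
      by auto
    have "0 = cinner (\<Sum>i<m. f (e i) *\<^sub>C e i) (e j)"
      using f by (simp add: sum.reindex[OF inj])
    also have "\<dots> = (\<Sum>i<m. f (e i) * of_bool (i = j))"
      unfolding cinner_simps using assms j by (intro sum.cong) (auto simp: onb_cinner)
    finally show "f x = 0"
      using j by (simp add: of_bool_def if_distrib[of "(*) _"] cong: if_cong)
  qed simp
qed

section \<open>Finite complex dimension and induction on it\<close>

definition has_cdim :: "'h::complex_inner set \<Rightarrow> nat \<Rightarrow> bool" where
  "has_cdim N m \<longleftrightarrow>
     (\<exists>B. finite B \<and> complex_vector.independent B \<and> card B = m \<and> complex_vector.span B = N)"

lemma has_cdim_unique:
  assumes "has_cdim N m" "has_cdim N n"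
  shows "m = n"
proof -
  have "complex_vector.dim N = k" if "has_cdim N k" for k
    using that complex_vector.dim_span_eq_card_independent unfolding has_cdim_def by blast
  then show ?thesis
    using assms by blast
qed

lemma onb_has_cdim: "onb m e N \<Longrightarrow> has_cdim N m"
  unfolding has_cdim_def using onb_independent by (metis finite_imageI finite_lessThan onb_def)

text \<open>The induction step of every construction of adapted bases: split off a unit vector,
  treat the rest of \<open>N\<close>, and put the vector back by \<open>onb_extend\<close>. Adding
  \<open>x\<close> to a basis of the hyperplane gives a basis of \<open>N\<close>, which fixes the
  count.\<close>

lemma has_cdim_hyperplane:
  assumes N: "has_cdim N (Suc m)" and x: "x \<in> N" "norm x = 1"
  shows "has_cdim (N \<inter> {y. cinner y x = 0}) m"
proof -
  let ?H = "N \<inter> {y. cinner y x = 0}"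
  obtain C where C: "finite C" "complex_vector.independent C" "card C = Suc m"
    "complex_vector.span C = N"
    using N by (auto simp: has_cdim_def)
  have sub: "complex_vector.subspace ?H"
    using C(4) by (auto simp: complex_vector.subspace_def cinner_simps
        complex_vector.span_zero complex_vector.span_add complex_vector.span_scale)
  obtain B where B: "B \<subseteq> ?H" "complex_vector.independent B" "?H \<subseteq> complex_vector.span B"
    using complex_vector.maximal_independent_subset by blast
  have spB: "complex_vector.span B = ?H"
    using B sub by (simp add: complex_vector.span_subspace)
  have xx: "cinner x x = 1"
    using x by (simp add: cinner_self)
  have finB: "finite B"
    using complex_vector.independent_span_bound[OF C(1) B(2)] B(1) C(4) by auto
  have "x \<notin> complex_vector.span B"
    unfolding spB using xx by auto
  then have ind: "complex_vector.independent (insert x B)" and "x \<notin> B"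
    using B(2) complex_vector.independent_insertI complex_vector.span_base by blast+
  have "complex_vector.span (insert x B) = N"
  proof (rule complex_vector.span_subspace)
    show "insert x B \<subseteq> N"
      using B(1) x by auto
    show "complex_vector.subspace N"
      using C(4) by auto
    show "N \<subseteq> complex_vector.span (insert x B)"
    proof
      fix y assume "y \<in> N"
      then have "y - cinner y x *\<^sub>C x \<in> ?H"
        using C(4) x xx by (auto simp: cinner_simps complex_vector.span_diff complex_vector.span_scale)
      then show "y \<in> complex_vector.span (insert x B)"
        unfolding complex_vector.span_breakdown_eq spB by blast
    qed
  qed
  then have "card (insert x B) = Suc m"
    using has_cdim_unique[OF _ N] ind finB unfolding has_cdim_def by (metis finite_insert)
  then show ?thesis
    using \<open>x \<notin> B\<close> finB B(2) spB unfolding has_cdim_def by (intro exI[of _ B]) auto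
qed

lemma has_cdim_0: "has_cdim N 0 \<longleftrightarrow> N = {0}"
  unfolding has_cdim_def by (auto simp: complex_vector.independent_empty)

lemma has_cdim_subspace: "has_cdim N m \<Longrightarrow> complex_vector.subspace N"
  unfolding has_cdim_def by auto

lemma has_cdim_Suc_unit:
  assumes "has_cdim N (Suc m)"
  obtains x where "x \<in> N" "norm x = 1"
proof -
  have "N \<noteq> {0}"
    using assms has_cdim_0 has_cdim_unique by (metis nat.distinct(1))
  then obtain y where y: "y \<in> N" "y \<noteq> 0"
    using complex_vector.subspace_0[OF has_cdim_subspace[OF assms]] by blast
  then have "norm (complex_of_real (1 / norm y) *\<^sub>C y) = 1"
    by (simp add: norm_divide)
  then show thesis
    using that y complex_vector.subspace_scale[OF has_cdim_subspace[OF assms]] by blast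
qed

lemma onb_extend:
  assumes e: "onb m e (N \<inter> {y. cinner y x = 0})" and x: "x \<in> N" "norm x = 1"
    and N: "complex_vector.subspace N"
  shows "onb (Suc m) (e(m := x)) N"
proof -
  have xx: "cinner x x = 1"
    using x by (simp add: cinner_self)
  have ex: "cinner (e i) x = 0" "cinner x (e i) = 0" "e i \<in> N" if "i < m" for i
    using onb_mem[OF e that] cinner_eq_0_commute[of x] by auto
  have img: "(e(m := x)) ` {..<Suc m} = insert x (e ` {..<m})"
    by (auto simp: lessThan_Suc)
  have "complex_vector.span (insert x (e ` {..<m})) = N"
  proof (rule complex_vector.span_subspace)
    show "N \<subseteq> complex_vector.span (insert x (e ` {..<m}))"
    proof
      fix y assume "y \<in> N"
      then have "y - cinner y x *\<^sub>C x \<in> N \<inter> {y. cinner y x = 0}"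
        using N x xx by (auto simp: cinner_simps complex_vector.subspace_diff complex_vector.subspace_scale)
      then show "y \<in> complex_vector.span (insert x (e ` {..<m}))"
        unfolding complex_vector.span_breakdown_eq using e unfolding onb_def by blast
    qed
  qed (use ex x N in auto)
  then show ?thesis
    unfolding onb_def img using onb_cinner[OF e] ex xx by (auto simp: less_Suc_eq)
qed

lemma has_cdim_onb:
  assumes "has_cdim N m"
  obtains e where "onb m e N"
  using assms
proof (induction m arbitrary: N thesis)
  case 0
  then show ?case
    by (auto simp: has_cdim_0 onb_def)
next
  case (Suc m)
  obtain x where x: "x \<in> N" "norm x = 1"
    using has_cdim_Suc_unit[OF Suc.prems(2)] .
  obtain e where "onb m e (N \<inter> {y. cinner y x = 0})"
    using Suc.IH has_cdim_hyperplane[OF Suc.prems(2) x] by blast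
  then show ?case
    using Suc.prems(1) onb_extend x has_cdim_subspace[OF Suc.prems(2)] by blast
qed

section \<open>Compact unit spheres and vectors that maximize a norm\<close>

lemma compact_combinations:
  fixes e :: "nat \<Rightarrow> 'h::complex_inner"
  shows "compact {\<Sum>i<m. c i *\<^sub>C e i | c. \<forall>i<m. norm (c i) \<le> (1::real)}"
proof (induction m)
  case 0
  have "{\<Sum>i<0. c i *\<^sub>C e i | c. \<forall>i<0. norm (c i) \<le> (1::real)} = {0}"
    by auto
  then show ?case
    by simp
next
  case (Suc m)
  let ?K = "\<lambda>m. {\<Sum>i<m. c i *\<^sub>C e i | c. \<forall>i<m. norm (c i) \<le> (1::real)}"
  have "?K (Suc m) = (\<lambda>(x, c). x + c *\<^sub>C e m) ` (?K m \<times> cball 0 1)" (is "?L = ?R")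
  proof
    show "?L \<subseteq> ?R"
    proof
      fix y assume "y \<in> ?L"
      then obtain c where c: "y = (\<Sum>i<Suc m. c i *\<^sub>C e i)" "\<forall>i<Suc m. norm (c i) \<le> 1"
        by auto
      then have "((\<Sum>i<m. c i *\<^sub>C e i), c m) \<in> ?K m \<times> cball 0 1"
        by auto
      then show "y \<in> ?R"
        using c by (intro image_eqI[where x = "((\<Sum>i<m. c i *\<^sub>C e i), c m)"]) auto
    qed
    show "?R \<subseteq> ?L"
    proof
      fix y assume "y \<in> ?R"
      then obtain c d where c: "y = (\<Sum>i<m. c i *\<^sub>C e i) + d *\<^sub>C e m"
        "\<forall>i<m. norm (c i) \<le> 1" "norm d \<le> 1"
        by auto
      then have "y = (\<Sum>i<Suc m. (c(m := d)) i *\<^sub>C e i)" "\<forall>i<Suc m. norm ((c(m := d)) i) \<le> 1"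
        by (auto simp: less_Suc_eq)
      then show "y \<in> ?L"
        by blast
    qed
  qed
  moreover have "continuous_on (?K m \<times> cball 0 1) (\<lambda>(x, c). x + c *\<^sub>C e m)"
    unfolding case_prod_unfold
    by (intro continuous_intros bounded_bilinear.continuous_on[OF bounded_bilinear_scaleC])
  ultimately show ?case
    using compact_continuous_image[OF _ compact_Times[OF Suc.IH compact_cball]] by simp
qed

text \<open>Coordinates of a unit vector in an orthonormal basis have modulus at most 1, so the
  sphere is a closed part of the compact set of combinations with such coefficients.\<close>

lemma compact_unit_sphere:
  assumes e: "onb m e N"
  shows "compact (N \<inter> {x. norm x = 1})"
proof -
  let ?K = "{\<Sum>i<m. c i *\<^sub>C e i | c. \<forall>i<m. norm (c i) \<le> (1::real)}"
  have "N \<inter> {x. norm x = 1} = ?K \<inter> {x. norm x = 1}"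
  proof (intro equalityI subsetI)
    fix x assume x: "x \<in> N \<inter> {x. norm x = 1}"
    then have "x = (\<Sum>i<m. cinner x (e i) *\<^sub>C e i)"
      using fproj_id[OF e] by (simp add: fproj_def)
    moreover have "\<forall>i<m. norm (cinner x (e i)) \<le> 1"
    proof (intro allI impI)
      fix i assume "i < m"
      then show "norm (cinner x (e i)) \<le> 1"
        using x norm_cinner_le[of x "e i"] onb_norm[OF e] by simp
    qed
    ultimately show "x \<in> ?K \<inter> {x. norm x = 1}"
      using x by (intro IntI CollectI exI[of _ "\<lambda>i. cinner x (e i)"]) auto
  next
    fix x assume "x \<in> ?K \<inter> {x. norm x = 1}"
    then show "x \<in> N \<inter> {x. norm x = 1}"
      by (auto intro!: complex_vector.subspace_sum complex_vector.subspace_scale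
          onb_subspace[OF e] onb_mem[OF e])
  qed
  moreover have "closed {x::'a. norm x = 1}"
    by (intro closed_Collect_eq continuous_intros)
  ultimately show ?thesis
    using compact_Int_closed[OF compact_combinations[of e m]] by presburger
qed

text \<open>A parabola through the origin that never rises above 0 has a horizontal tangent there.
  This is the first-variation argument for maximal vectors and for nearest points.\<close>

lemma quadratic_nonpos_linear_coeff_zero:
  fixes b c :: real
  assumes "\<And>s. s * b + s\<^sup>2 * c \<le> 0"
  shows "b = 0"
proof (rule ccontr)
  assume "b \<noteq> 0"
  \<comment> \<open>Any \<open>d\<close> with \<open>d > 0\<close> and \<open>d + c > 0\<close>
    makes the value at \<open>s = b / d\<close> positive.\<close>
  define d where "d = 1 + \<bar>c\<bar>"
  have d: "d > 0" "d + c > 0"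
    unfolding d_def by auto
  have "b / d * b + (b / d)\<^sup>2 * c = b\<^sup>2 / d\<^sup>2 * (d + c)"
    using d by (simp add: power2_eq_square field_simps)
  moreover have "b\<^sup>2 / d\<^sup>2 * (d + c) > 0"
    using d \<open>b \<noteq> 0\<close> by simp
  ultimately show False
    using assms[of "b / d"] by simp
qed

text \<open>A unit vector where \<open>norm (A x)\<close> is maximal on \<open>N\<close> is an
  eigenvector of the compression of the positive operator \<open>A* A\<close> to \<open>N\<close>.
  The last conclusion expresses this without an adjoint: perturbing \<open>x\<close> by
  \<open>s *\<^sub>R y\<close> must not increase the quotient of norms to first order.\<close>

lemma maximal_vector:
  assumes N: "has_cdim N (Suc m)" and A: "bounded_clinear A"
  obtains x where "x \<in> N" "norm x = 1" "\<And>y. y \<in> N \<Longrightarrow> norm (A y) \<le> norm (A x) * norm y"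
    "\<And>y. y \<in> N \<Longrightarrow> cinner y x = 0 \<Longrightarrow> cinner (A x) (A y) = 0"
proof -
  interpret A: bounded_linear A
    using A by (simp add: bounded_clinear_def)
  have AC: "A (c *\<^sub>C x) = c *\<^sub>C A x" for c x
    using A by (simp add: bounded_clinear_def)
  note sub = has_cdim_subspace[OF N]
  obtain e where e: "onb (Suc m) e N"
    using has_cdim_onb[OF N] .
  have "N \<inter> {x. norm x = 1} \<noteq> {}"
    using has_cdim_Suc_unit[OF N] by blast
  moreover have "continuous_on (N \<inter> {x. norm x = 1}) (\<lambda>x. norm (A x))"
    by (intro continuous_intros A.continuous_on)
  ultimately obtain x where x: "x \<in> N" "norm x = 1"
    and max: "\<And>y. y \<in> N \<Longrightarrow> norm y = 1 \<Longrightarrow> norm (A y) \<le> norm (A x)"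
    using continuous_attains_sup[OF compact_unit_sphere[OF e]] by (metis (mono_tags) IntE IntI mem_Collect_eq)
  have max': "norm (A y) \<le> norm (A x) * norm y" if "y \<in> N" for y
  proof (cases "y = 0")
    case False
    have "norm (A (complex_of_real (1 / norm y) *\<^sub>C y)) \<le> norm (A x)"
      using False that by (intro max complex_vector.subspace_scale[OF sub]) (auto simp: norm_divide)
    then show ?thesis
      using False by (simp add: AC norm_divide field_simps)
  qed (simp add: A.zero)
  have Re0: "Re (cinner (A x) (A y)) = 0" if y: "y \<in> N" "cinner y x = 0" for y
  proof -
    have "s * (2 * inner (A x) (A y)) + s\<^sup>2 * ((norm (A y))\<^sup>2 - (norm (A x))\<^sup>2 * (norm y)\<^sup>2) \<le> 0" for s
    proof -
      have "x + s *\<^sub>R y \<in> N"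
        using x y by (auto simp: scaleR_scaleC intro!: complex_vector.subspace_add[OF sub]
            complex_vector.subspace_scale[OF sub])
      from power_mono[OF max'[OF this], of 2]
      have "(norm (A x + s *\<^sub>R A y))\<^sup>2 \<le> (norm (A x))\<^sup>2 * (norm (x + s *\<^sub>R y))\<^sup>2"
        by (simp add: A.add A.scaleR power_mult_distrib)
      moreover have "(norm (u + s *\<^sub>R v))\<^sup>2 = (norm u)\<^sup>2 + 2 * s * inner u v + s\<^sup>2 * (norm v)\<^sup>2"
        for u v :: 'a
        unfolding power2_norm_eq_inner
        by (simp add: inner_add inner_commute[of v u] power2_eq_square[of s] algebra_simps)
      moreover have "inner x y = 0"
        using y cinner_eq_0_commute[of x y] by (simp add: inner_eq_Re_cinner)
      ultimately show ?thesis
        using x by (simp add: algebra_simps)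
    qed
    from quadratic_nonpos_linear_coeff_zero[OF this] show ?thesis
      by (simp add: inner_eq_Re_cinner)
  qed
  show thesis
  proof (rule that[OF x max'])
    fix y assume y: "y \<in> N" "cinner y x = 0"
    \<comment> \<open>The variation controls only real parts; replacing \<open>y\<close> by
      \<open>\<i> *\<^sub>C y\<close> turns the imaginary part into a real one.\<close>
    have "Re (cinner (A x) (A (\<i> *\<^sub>C y))) = 0"
      using y by (intro Re0) (auto simp: cinner_simps complex_vector.subspace_scale[OF sub])
    then show "cinner (A x) (A y) = 0"
      using Re0[OF y] by (simp add: AC cinner_simps complex_eq_iff)
  qed
qed

text \<open>A singular value decomposition of \<open>A\<close> on \<open>N\<close>, by deflation:
  after a maximal vector \<open>x\<close> is removed, the images of the remaining vectors are
  orthogonal to \<open>A x\<close>.\<close>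

lemma onb_orthogonal_images:
  assumes "has_cdim N m" and A: "bounded_clinear A"
  obtains e where "onb m e N"
    "\<And>i j. i < m \<Longrightarrow> j < m \<Longrightarrow> i \<noteq> j \<Longrightarrow> cinner (A (e i)) (A (e j)) = 0"
  using assms(1)
proof (induction m arbitrary: N thesis)
  case 0
  then show ?case
    by (auto simp: has_cdim_0 onb_def)
next
  case (Suc m)
  obtain x where x: "x \<in> N" "norm x = 1"
    and Ax: "\<And>y. y \<in> N \<Longrightarrow> cinner y x = 0 \<Longrightarrow> cinner (A x) (A y) = 0"
    by (rule maximal_vector[OF Suc.prems(2) A]) (rule that)
  obtain e where e: "onb m e (N \<inter> {y. cinner y x = 0})"
    and Ae: "\<And>i j. i < m \<Longrightarrow> j < m \<Longrightarrow> i \<noteq> j \<Longrightarrow> cinner (A (e i)) (A (e j)) = 0"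
    using Suc.IH has_cdim_hyperplane[OF Suc.prems(2) x] by blast
  have Ax': "cinner (A x) (A (e i)) = 0" "cinner (A (e i)) (A x) = 0" if "i < m" for i
    using Ax onb_mem[OF e that] cinner_commute[of "A (e i)"] by auto
  show ?case
    by (rule Suc.prems(1)[OF onb_extend[OF e x has_cdim_subspace[OF Suc.prems(2)]]])
      (use Ax' Ae in \<open>auto simp: less_Suc_eq\<close>)
qed

section \<open>Rotations of a frame\<close>

definition rot_e :: "(nat \<Rightarrow> 'h::complex_inner) \<Rightarrow> (nat \<Rightarrow> 'h) \<Rightarrow> (nat \<Rightarrow> real) \<Rightarrow> real \<Rightarrow> nat \<Rightarrow> 'h"
  where "rot_e e g l t i = cos (t * l i) *\<^sub>R e i + sin (t * l i) *\<^sub>R g i"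

text \<open>A quarter turn ahead of \<open>rot_e\<close>, so that \<open>l i\<close> times it is the
  velocity of \<open>rot_e\<close>.\<close>

definition rot_g :: "(nat \<Rightarrow> 'h::complex_inner) \<Rightarrow> (nat \<Rightarrow> 'h) \<Rightarrow> (nat \<Rightarrow> real) \<Rightarrow> real \<Rightarrow> nat \<Rightarrow> 'h"
  where "rot_g e g l t i = cos (t * l i) *\<^sub>R g i - sin (t * l i) *\<^sub>R e i"

text \<open>The skew-adjoint generator of the simultaneous rotations in the planes of
  \<open>e i\<close> and \<open>g i\<close>; for a geodesic it is the operator \<open>X\<close>
  times the imaginary unit.\<close>

definition rot_gen ::
    "nat \<Rightarrow> (nat \<Rightarrow> 'h::complex_inner) \<Rightarrow> (nat \<Rightarrow> 'h) \<Rightarrow> (nat \<Rightarrow> real) \<Rightarrow> 'h \<Rightarrow> 'h"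
  where "rot_gen m e g l x =
    (\<Sum>i<m. l i *\<^sub>R (cinner x (e i) *\<^sub>C g i - cinner x (g i) *\<^sub>C e i))"

lemma sum_of_bool_eq:
  fixes f :: "nat \<Rightarrow> 'a::semiring_1"
  assumes "j < m"
  shows "(\<Sum>i<m. f i * of_bool (i = j)) = f j"
proof -
  have "(\<Sum>i<m. f i * of_bool (i = j)) = (\<Sum>i\<in>{j}. f i)"
    using assms by (intro sum.mono_neutral_cong_right) auto
  then show ?thesis
    by simp
qed

lemma cos_sin_scaleR: "cos z *\<^sub>R cos z *\<^sub>R x + sin z *\<^sub>R sin z *\<^sub>R x = (x::'a::real_vector)"
  by (simp add: scaleR_add_left[symmetric] power2_eq_square[symmetric])

lemma rot_e_back: "cos (t * l i) *\<^sub>R rot_e e g l t i - sin (t * l i) *\<^sub>R rot_g e g l t i = e i"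
  using cos_sin_scaleR[of "t * l i" "e i"]
  by (simp add: rot_e_def rot_g_def scaleR_add_right scaleR_diff_right mult.commute)

lemma rot_g_back: "sin (t * l i) *\<^sub>R rot_e e g l t i + cos (t * l i) *\<^sub>R rot_g e g l t i = g i"
  using cos_sin_scaleR[of "t * l i" "g i"]
  by (simp add: rot_e_def rot_g_def scaleR_add_right scaleR_diff_right mult.commute add.commute)

text \<open>
  Degenerate planes, those with \<open>l i = 0\<close>, are encoded by \<open>g i = 0\<close>.
\<close>

locale frame =
  fixes m :: nat and e g :: "nat \<Rightarrow> 'h::chilbert_space" and l :: "nat \<Rightarrow> real"
  assumes ee: "\<And>i j. i < m \<Longrightarrow> j < m \<Longrightarrow> cinner (e i) (e j) = of_bool (i = j)"
    and eg: "\<And>i j. i < m \<Longrightarrow> j < m \<Longrightarrow> cinner (e i) (g j) = 0"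
    and gg: "\<And>i j. i < m \<Longrightarrow> j < m \<Longrightarrow> cinner (g i) (g j) = of_bool (i = j \<and> l i \<noteq> 0)"
    and l_nonneg: "\<And>i. i < m \<Longrightarrow> 0 \<le> l i"
begin

abbreviation u :: "real \<Rightarrow> nat \<Rightarrow> 'h" where "u \<equiv> rot_e e g l"
abbreviation w :: "real \<Rightarrow> nat \<Rightarrow> 'h" where "w \<equiv> rot_g e g l"
abbreviation gen :: "'h \<Rightarrow> 'h" where "gen \<equiv> rot_gen m e g l"

lemma ge: "i < m \<Longrightarrow> j < m \<Longrightarrow> cinner (g i) (e j) = 0"
  using eg cinner_eq_0_commute by blast

lemma g_zero: "i < m \<Longrightarrow> l i = 0 \<Longrightarrow> g i = 0"
  using gg[of i i] by simp

text \<open>The relations of a frame persist in time, so a statement about time 0, such as the norm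
  of the velocity, holds at every \<open>t\<close>.\<close>

lemma frame_rot: "frame m (u t) (w t) l"
proof
  fix i j assume ij: "i < m" "j < m"
  have cs: "complex_of_real (cos z) * complex_of_real (cos z) +
      complex_of_real (sin z) * complex_of_real (sin z) = 1" for z
    by (simp flip: of_real_mult of_real_add)
  show "cinner (u t i) (u t j) = of_bool (i = j)"
    using cs[of "t * l i"] ij by (cases "l i = 0") (auto simp: rot_e_def cinner_simps ee eg ge gg g_zero)
  show "cinner (u t i) (w t j) = 0"
    using ij by (cases "l i = 0"; cases "i = j") (auto simp: rot_e_def rot_g_def cinner_simps ee eg ge gg g_zero)
  show "cinner (w t i) (w t j) = of_bool (i = j \<and> l i \<noteq> 0)"
    using cs[of "t * l i"] ij
    by (cases "l i = 0"; cases "i = j") (auto simp: rot_g_def cinner_simps ee eg ge gg g_zero)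
qed (rule l_nonneg)

lemma cinner_gen_e: "j < m \<Longrightarrow> cinner (gen x) (e j) = - (l j * cinner x (g j))"
proof -
  assume j: "j < m"
  have "cinner (gen x) (e j) = (\<Sum>i<m. - (l i * cinner x (g i)) * of_bool (i = j))"
    unfolding rot_gen_def cinner_simps using j by (intro sum.cong) (auto simp: ee ge)
  then show ?thesis
    by (simp only: sum_of_bool_eq[OF j])
qed

lemma bounded_linear_gen: "bounded_linear gen"
  unfolding rot_gen_def
  by (intro bounded_linear_sum bounded_linear_sub bounded_linear_const_scaleR
      bounded_linear_compose[OF bounded_bilinear.bounded_linear_left[OF bounded_bilinear_scaleC]
        bounded_linear_cinner_left])

lemma gen_scaleC: "gen (c *\<^sub>C x) = c *\<^sub>C gen x"
  unfolding rot_gen_def complex_vector.scale_sum_right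
  by (intro sum.cong refl) (simp add: cinner_simps scaleC_scaleR scaleC_scaleC
      complex_vector.scale_right_diff_distrib scaleR_diff_right)

lemma gen_skew: "cinner (gen x) y = - cinner x (gen y)"
  unfolding rot_gen_def cinner_simps sum_negf[symmetric]
  by (intro sum.cong refl) (simp add: cinner_commute[of "e _" y] cinner_commute[of "g _" y] algebra_simps)

text \<open>The factor makes the skew-adjoint generator self-adjoint, and \<open>\<i>\<close> times
  \<open>op\<close> is \<open>gen\<close> again.\<close>

definition op :: "'h \<Rightarrow> 'h" where "op x = (- \<i>) *\<^sub>C gen x"

lemma op_bounded_clinear: "bounded_clinear op"
proof -
  have "bounded_linear (\<lambda>x. (- \<i>) *\<^sub>C gen x)"
    by (rule bounded_linear_compose[OF bounded_bilinear.bounded_linear_right[OF bounded_bilinear_scaleC]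
        bounded_linear_gen])
  then show ?thesis
    by (simp add: bounded_clinear_def op_def[abs_def] gen_scaleC scaleC_scaleC mult.commute)
qed

lemma op_selfadjoint: "selfadjoint op"
  by (simp add: selfadjoint_def op_def cinner_simps gen_skew)

lemma op_codiagonal: "codiagonal (orth_compl (e ` {..<m})) op"
proof -
  have "op x \<in> orth_compl (orth_compl (e ` {..<m}))" if "x \<in> orth_compl (e ` {..<m})" for x
    using that unfolding orth_compl_def
    by (auto simp: op_def rot_gen_def cinner_simps cinner_eq_0_commute[of "e _"] intro!: sum.neutral)
  \<comment> \<open>Each \<open>g j\<close> lies in the complement of the \<open>e i\<close>, so
    \<open>x\<close> in the double complement is orthogonal to it and \<open>cinner_gen_e\<close>
    gives 0.\<close>
  moreover have "op x \<in> orth_compl (e ` {..<m})" if "x \<in> orth_compl (orth_compl (e ` {..<m}))" for x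
    using that unfolding orth_compl_def
    by (auto simp: op_def cinner_simps cinner_gen_e ge)
  ultimately show ?thesis
    by (auto simp: codiagonal_def)
qed

section \<open>The exponential of the generator, plane by plane\<close>

definition p :: "'h \<Rightarrow> nat \<Rightarrow> 'h" where
  "p x i = cinner x (e i) *\<^sub>C e i + cinner x (g i) *\<^sub>C g i"

text \<open>The component \<open>p x i\<close> of \<open>x\<close> in plane \<open>i\<close>, turned
  by a right angle.\<close>

definition q :: "'h \<Rightarrow> nat \<Rightarrow> 'h" where
  "q x i = cinner x (e i) *\<^sub>C g i - cinner x (g i) *\<^sub>C e i"

lemma gen_eq: "gen x = (\<Sum>i<m. l i *\<^sub>R q x i)"
  by (simp add: rot_gen_def q_def)

lemma gen_e: "j < m \<Longrightarrow> gen (e j) = l j *\<^sub>R g j"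
proof -
  assume j: "j < m"
  have "gen (e j) = (\<Sum>i\<in>{j}. l i *\<^sub>R g i)"
    unfolding rot_gen_def using j by (intro sum.mono_neutral_cong_right) (auto simp: ee eg)
  then show ?thesis
    by simp
qed

lemma gen_g: "j < m \<Longrightarrow> gen (g j) = - (l j *\<^sub>R e j)"
proof -
  assume j: "j < m"
  have "gen (g j) = (\<Sum>i\<in>{j}. - (l i *\<^sub>R e i))"
    unfolding rot_gen_def using j by (intro sum.mono_neutral_cong_right) (auto simp: ge gg)
  then show ?thesis
    by simp
qed

lemma gen_p: "j < m \<Longrightarrow> gen (p x j) = l j *\<^sub>R q x j"
  by (simp add: p_def q_def linear_add[OF bounded_linear.linear[OF bounded_linear_gen]] gen_scaleC
      gen_e gen_g scaleC_scaleR scaleR_diff_right)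

lemma gen_q: "j < m \<Longrightarrow> gen (q x j) = - (l j *\<^sub>R p x j)"
  by (simp add: p_def q_def linear_diff[OF bounded_linear.linear[OF bounded_linear_gen]] gen_scaleC
      gen_e gen_g scaleC_scaleR scaleR_add_right)

lemma cinner_sum_p:
  assumes j: "j < m"
  shows "cinner (\<Sum>i<m. p x i) (e j) = cinner x (e j)"
    and "cinner (\<Sum>i<m. p x i) (g j) = cinner x (g j)"
proof -
  have "cinner (\<Sum>i<m. p x i) (e j) = (\<Sum>i<m. cinner x (e i) * of_bool (i = j))"
    unfolding p_def cinner_simps using j by (intro sum.cong) (auto simp: ee ge)
  then show "cinner (\<Sum>i<m. p x i) (e j) = cinner x (e j)"
    using sum_of_bool_eq[OF j] by simp
  have "cinner (\<Sum>i<m. p x i) (g j) = (\<Sum>i<m. cinner x (g i) * of_bool (i = j))"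
    unfolding p_def cinner_simps using j by (intro sum.cong) (auto simp: gg eg g_zero)
  then show "cinner (\<Sum>i<m. p x i) (g j) = cinner x (g j)"
    using sum_of_bool_eq[OF j] by simp
qed

lemma gen_residue: "gen (x - (\<Sum>i<m. p x i)) = 0"
  unfolding rot_gen_def by (intro sum.neutral) (simp add: cinner_diff_left cinner_sum_p)

text \<open>In plane \<open>i\<close> the generator maps \<open>p\<close> to \<open>l i\<close>
  times \<open>q\<close> and \<open>q\<close> to \<open>- l i\<close> times \<open>p\<close>, so its
  powers run through the coefficients of cosine and sine. The part of \<open>x\<close> orthogonal to
  all planes is annihilated and occurs only for \<open>n = 0\<close>.\<close>

lemma gen_power:
  "((\<lambda>x. t *\<^sub>R gen x) ^^ n) x /\<^sub>R fact n = (if n = 0 then x - (\<Sum>i<m. p x i) else 0) +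
     (\<Sum>i<m. (cos_coeff n *\<^sub>R (t * l i) ^ n) *\<^sub>R p x i + (sin_coeff n *\<^sub>R (t * l i) ^ n) *\<^sub>R q x i)"
proof (induction n)
  case (Suc n)
  interpret gen: bounded_linear gen
    by (rule bounded_linear_gen)
  have "((\<lambda>x. t *\<^sub>R gen x) ^^ Suc n) x /\<^sub>R fact (Suc n) =
      (t / real (Suc n)) *\<^sub>R gen (((\<lambda>x. t *\<^sub>R gen x) ^^ n) x /\<^sub>R fact n)"
    by (simp add: gen.scaleR field_simps del: of_nat_Suc)
  also have "\<dots> = (t / real (Suc n)) *\<^sub>R (\<Sum>i<m. (cos_coeff n * (t * l i) ^ n) *\<^sub>R l i *\<^sub>R q x i -
      (sin_coeff n * (t * l i) ^ n) *\<^sub>R l i *\<^sub>R p x i)"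
    unfolding Suc.IH gen.add gen.sum gen.scaleR
    by (simp add: gen.zero gen_residue gen_p gen_q del: of_nat_Suc)
  also have "\<dots> = (\<Sum>i<m. (cos_coeff (Suc n) *\<^sub>R (t * l i) ^ Suc n) *\<^sub>R p x i +
      (sin_coeff (Suc n) *\<^sub>R (t * l i) ^ Suc n) *\<^sub>R q x i)"
    unfolding scaleR_sum_right
    by (intro sum.cong refl) (simp add: cos_coeff_Suc sin_coeff_Suc scaleR_diff_right mult_ac del: of_nat_Suc)
  finally show ?case
    by simp
qed simp

lemma op_exp_gen:
  "op_exp (\<lambda>x. t *\<^sub>R gen x) x =
     x - (\<Sum>i<m. p x i) + (\<Sum>i<m. cos (t * l i) *\<^sub>R p x i + sin (t * l i) *\<^sub>R q x i)"
proof -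
  have "(\<lambda>n. if n = 0 then x - (\<Sum>i<m. p x i) else 0) sums (x - (\<Sum>i<m. p x i))"
    using sums_If_finite[of "\<lambda>n. n = 0" "\<lambda>_. x - (\<Sum>i<m. p x i)"] by simp
  moreover have "(\<lambda>n. \<Sum>i<m. (cos_coeff n *\<^sub>R (t * l i) ^ n) *\<^sub>R p x i + (sin_coeff n *\<^sub>R (t * l i) ^ n) *\<^sub>R q x i)
      sums (\<Sum>i<m. cos (t * l i) *\<^sub>R p x i + sin (t * l i) *\<^sub>R q x i)"
    by (intro sums_sum sums_add bounded_linear.sums[OF bounded_linear_scaleR_left]
        cos_converges sin_converges)
  ultimately show ?thesis
    unfolding op_exp_def gen_power by (intro sums_unique[symmetric] sums_add)
qed

lemma op_exp_image:
  "op_exp (\<lambda>x. t *\<^sub>R gen x) ` orth_compl (e ` {..<m}) = orth_compl (u t ` {..<m})"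
proof -
  interpret R: frame m "u t" "w t" l
    by (rule frame_rot)
  \<comment> \<open>For \<open>x\<close> orthogonal to all \<open>e i\<close>, only the components
    along the \<open>g i\<close> move: each \<open>g i\<close> is replaced by its rotated copy
    \<open>w t i\<close>.\<close>
  have U: "op_exp (\<lambda>x. t *\<^sub>R gen x) x =
      x - (\<Sum>i<m. cinner x (g i) *\<^sub>C g i) + (\<Sum>i<m. cinner x (g i) *\<^sub>C w t i)"
    if "x \<in> orth_compl (e ` {..<m})" for x
  proof -
    have "cinner x (e i) = 0" if "i < m" for i
      using that \<open>x \<in> _\<close> by (auto simp: orth_compl_def)
    then show ?thesis
      unfolding op_exp_gen
      by (simp add: p_def q_def rot_g_def complex_vector.scale_right_diff_distrib scaleC_scaleR)
  qed
  have ug: "cinner (g i) (u t j) = sin (t * l i) * of_bool (i = j)" if "i < m" "j < m" for i j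
    using that by (auto simp: rot_e_def cinner_simps ge gg)
  have we: "cinner (w t i) (e j) = - sin (t * l i) * of_bool (i = j)" if "i < m" "j < m" for i j
    using that by (auto simp: rot_g_def cinner_simps ge ee)
  have wg: "cinner (w t i) (g j) = cos (t * l i) * of_bool (i = j \<and> l i \<noteq> 0)" if "i < m" "j < m" for i j
    using that by (auto simp: rot_g_def cinner_simps eg gg)
  show ?thesis
  proof (intro equalityI subsetI)
    fix y assume "y \<in> op_exp (\<lambda>x. t *\<^sub>R gen x) ` orth_compl (e ` {..<m})"
    then obtain x where x: "x \<in> orth_compl (e ` {..<m})"
      and y: "y = x - (\<Sum>i<m. cinner x (g i) *\<^sub>C g i) + (\<Sum>i<m. cinner x (g i) *\<^sub>C w t i)"
      using U by auto
    have "cinner y (u t j) = 0" if j: "j < m" for j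
    proof -
      have "cinner x (e j) = 0"
        using x j by (auto simp: orth_compl_def)
      then have "cinner x (u t j) = sin (t * l j) * cinner x (g j)"
        by (simp add: rot_e_def cinner_simps)
      moreover have "(\<Sum>i<m. cinner x (g i) * cinner (g i) (u t j)) =
          (\<Sum>i<m. (sin (t * l i) * cinner x (g i)) * of_bool (i = j))"
        using j by (intro sum.cong) (auto simp: ug)
      ultimately show ?thesis
        unfolding y cinner_simps using j by (simp add: sum_of_bool_eq[OF j] R.ge)
    qed
    then show "y \<in> orth_compl (u t ` {..<m})"
      by (auto simp: orth_compl_def)
  next
    fix y assume "y \<in> orth_compl (u t ` {..<m})"
    then have yu: "cinner y (u t j) = 0" if "j < m" for j
      using that by (auto simp: orth_compl_def)
    \<comment> \<open>The inverse rotation applied to \<open>y\<close>. Since \<open>y\<close> is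
      orthogonal to \<open>u t i\<close>, its component in plane \<open>i\<close> is a multiple of
      \<open>w t i\<close>, which is turned back to \<open>g i\<close>.\<close>
    define x where "x = y + (\<Sum>i<m. cinner y (w t i) *\<^sub>C (g i - w t i))"
    have ye: "cinner y (e j) = - sin (t * l j) * cinner y (w t j)" if "j < m" for j
      using arg_cong[OF rot_e_back[of t l j e g], of "cinner y"] yu[OF that]
      by (simp add: cinner_simps)
    have yg: "cinner y (g j) = cos (t * l j) * cinner y (w t j)" if "j < m" for j
      using arg_cong[OF rot_g_back[of t l j e g], of "cinner y"] yu[OF that]
      by (simp add: cinner_simps)
    have "cinner x (e j) = 0" if j: "j < m" for j
    proof -
      have "(\<Sum>i<m. cinner y (w t i) * (cinner (g i) (e j) - cinner (w t i) (e j))) =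
          (\<Sum>i<m. (sin (t * l i) * cinner y (w t i)) * of_bool (i = j))"
        using j by (intro sum.cong) (auto simp: we ge)
      then show ?thesis
        unfolding x_def cinner_simps using j by (simp add: sum_of_bool_eq[OF j] ye)
    qed
    then have x: "x \<in> orth_compl (e ` {..<m})"
      by (auto simp: orth_compl_def)
    have xg: "cinner x (g j) = cinner y (w t j)" if j: "j < m" for j
    proof -
      \<comment> \<open>In a degenerate plane \<open>wg\<close> gives 0 instead of a cosine; there
        the coefficient \<open>cinner y (w t j)\<close> vanishes as well.\<close>
      have "w t j = 0" if "l j = 0"
        using that j by (simp add: rot_g_def g_zero)
      then have "(\<Sum>i<m. cinner y (w t i) * (cinner (g i) (g j) - cinner (w t i) (g j))) =
          (\<Sum>i<m. ((1 - cos (t * l i)) * cinner y (w t i)) * of_bool (i = j))"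
        using j by (intro sum.cong) (auto simp: wg gg algebra_simps)
      also have "\<dots> = (1 - cos (t * l j)) * cinner y (w t j)"
        by (rule sum_of_bool_eq[OF j])
      finally show ?thesis
        unfolding x_def cinner_simps by (simp add: yg[OF j] left_diff_distrib)
    qed
    have "op_exp (\<lambda>x. t *\<^sub>R gen x) x = y"
      unfolding U[OF x] using xg
      by (simp add: x_def complex_vector.scale_right_diff_distrib sum_subtractf)
    then show "y \<in> op_exp (\<lambda>x. t *\<^sub>R gen x) ` orth_compl (e ` {..<m})"
      using x by blast
  qed
qed

lemma op_exp_op_image:
  "op_exp (\<lambda>x. (\<i> * complex_of_real t) *\<^sub>C op x) ` orth_compl (e ` {..<m}) =
     orth_compl (u t ` {..<m})"
proof -
  have "\<i> * complex_of_real t * (- \<i>) = complex_of_real t"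
    by (simp add: complex_eq_iff)
  then show ?thesis
    using op_exp_image[of t] by (simp only: op_def scaleC_scaleC scaleR_scaleC)
qed

end

text \<open>On the complement of \<open>N\<close> the value \<open>A x\<close> lies in
  \<open>N\<close>, so it is determined by the numbers
  \<open>cinner (A x) (e i) = cinner x (A (e i))\<close>.\<close>

lemma codiagonal_eqI:
  assumes e: "onb m e N"
    and A: "bounded_clinear A" "selfadjoint A" "codiagonal (orth_compl N) A"
    and B: "bounded_clinear B" "selfadjoint B" "codiagonal (orth_compl N) B"
    and eq: "\<And>i. i < m \<Longrightarrow> A (e i) = B (e i)"
  shows "A = B"
proof
  fix x
  interpret A: bounded_linear A
    using A(1) by (simp add: bounded_clinear_def)
  interpret B: bounded_linear B
    using B(1) by (simp add: bounded_clinear_def)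
  have AC: "A (c *\<^sub>C x) = c *\<^sub>C A x" "B (c *\<^sub>C x) = c *\<^sub>C B x" for c x
    using A(1) B(1) by (simp_all add: bounded_clinear_def)
  define n where "n = fproj m e x"
  have "A n = B n"
    unfolding n_def fproj_def A.sum B.sum AC by (simp add: eq)
  have "x - n \<in> orth_compl N"
    unfolding n_def by (rule fproj_orth[OF e])
  then have "A (x - n) \<in> N" "B (x - n) \<in> N"
    using A(3) B(3) onb_orth_compl_orth_compl[OF e] by (auto simp: codiagonal_def)
  then have "A (x - n) - B (x - n) \<in> N"
    by (rule complex_vector.subspace_diff[OF onb_subspace[OF e]])
  moreover have "A (x - n) - B (x - n) \<in> orth_compl N"
    using A(2) B(2) eq by (auto simp: onb_orth_compl[OF e] cinner_diff_left selfadjoint_def)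
  ultimately have "A (x - n) = B (x - n)"
    using orth_compl_mem_zero[of "A (x - n) - B (x - n)" N] by simp
  then have "A (n + (x - n)) = B (n + (x - n))"
    using \<open>A n = B n\<close> by (simp only: A.add B.add)
  then show "A x = B x"
    by simp
qed

text \<open>The singular values of \<open>A\<close> on \<open>N\<close> become the angular
  velocities, and the normalized images of the singular vectors, which lie in the complement of
  \<open>N\<close>, become the \<open>g i\<close> up to a phase.\<close>

lemma codiagonal_normal_form:
  fixes A :: "'h::chilbert_space \<Rightarrow> 'h"
  assumes N: "has_cdim N m" and A: "bounded_clinear A" "selfadjoint A" "codiagonal (orth_compl N) A"
  obtains e g l where "frame m e g l" "onb m e N" "A = frame.op m e g l"
proof -
  obtain e where e: "onb m e N"
    and ort: "\<And>i j. i < m \<Longrightarrow> j < m \<Longrightarrow> i \<noteq> j \<Longrightarrow> cinner (A (e i)) (A (e j)) = 0"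
    using onb_orthogonal_images[OF N A(1)] by blast
  define l where "l i = norm (A (e i))" for i
  \<comment> \<open>The factor \<open>\<i>\<close> cancels the \<open>- \<i>\<close> in
    \<open>op\<close>. If \<open>l i = 0\<close>, division by zero yields \<open>g i = 0\<close>, as
    a frame demands.\<close>
  define g where "g i = (\<i> / complex_of_real (l i)) *\<^sub>C A (e i)" for i
  have AeS: "A (e i) \<in> orth_compl N" if "i < m" for i
    using A(3) onb_mem[OF e that] onb_orth_compl_orth_compl[OF e] by (auto simp: codiagonal_def)
  have Ag: "A (e i) = (- \<i>) *\<^sub>C (l i *\<^sub>R g i)" for i
    by (cases "l i = 0") (simp_all add: g_def l_def scaleR_scaleC scaleC_scaleC)
  have fr: "frame m e g l"
  proof
    fix i j assume ij: "i < m" "j < m"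
    show "cinner (e i) (e j) = of_bool (i = j)"
      using onb_cinner[OF e ij] .
    have "cinner (A (e j)) (e i) = 0"
      using AeS[OF ij(2)] onb_mem[OF e ij(1)] by (auto simp: orth_compl_def)
    then show "cinner (e i) (g j) = 0"
      by (simp add: cinner_eq_0_commute[of "e i"] g_def cinner_simps)
    show "cinner (g i) (g j) = of_bool (i = j \<and> l i \<noteq> 0)"
      using ort[OF ij] by (cases "i = j")
        (auto simp: g_def cinner_simps cinner_self l_def power2_eq_square norm_divide)
  qed (simp add: l_def)
  interpret frame m e g l
    by (rule fr)
  have "codiagonal (orth_compl N) op"
    using op_codiagonal e orth_compl_span[of "e ` {..<m}"] by (simp add: onb_def)
  then have "A = op"
    by (rule codiagonal_eqI[OF e A op_bounded_clinear op_selfadjoint])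
      (simp add: Ag op_def gen_e)
  then show thesis
    using that[OF fr e] by blast
qed

section \<open>Curves of projections\<close>

lemma Gr_subspace: "S \<in> Gr \<Longrightarrow> complex_vector.subspace S"
  by (simp add: Gr_def)

section \<open>Existence and basic properties of orthogonal projections\<close>

lemma orth_proj_eqI:
  assumes S: "complex_vector.subspace S" and y: "y \<in> S" "x - y \<in> orth_compl S"
  shows "orth_proj S x = y"
  unfolding orth_proj_def
proof (rule the_equality)
  fix z assume z: "z \<in> S \<and> x - z \<in> orth_compl S"
  have "(x - y) - (x - z) \<in> orth_compl S"
    using y z by (blast intro: complex_vector.subspace_diff[OF subspace_orth_compl])
  then have "z - y \<in> orth_compl S"
    by simp
  moreover have "z - y \<in> S"
    using y z S by (intro complex_vector.subspace_diff) auto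
  ultimately show "z = y"
    using orth_compl_mem_zero[of "z - y" S] by simp
qed (use y in simp)

lemma orth_complI_minimal:
  assumes S: "complex_vector.subspace S"
    and min: "\<And>z. z \<in> S \<Longrightarrow> norm x \<le> norm (x - z)"
  shows "x \<in> orth_compl S"
proof -
  have inner0: "inner x z = 0" if z: "z \<in> S" for z
  proof -
    have "s * (2 * inner x z) + s\<^sup>2 * (- (norm z)\<^sup>2) \<le> 0" for s
    proof -
      have "s *\<^sub>R z \<in> S"
        using z S by (simp add: scaleR_scaleC complex_vector.subspace_scale)
      from power_mono[OF min[OF this], of 2]
      have "(norm x)\<^sup>2 \<le> (norm (x - s *\<^sub>R z))\<^sup>2"
        by simp
      also have "\<dots> = (norm x)\<^sup>2 - 2 * s * inner x z + s\<^sup>2 * (norm z)\<^sup>2"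
        unfolding power2_norm_eq_inner
        by (simp add: inner_diff inner_commute[of z x] power2_eq_square[of s] algebra_simps)
      finally show ?thesis
        by simp
    qed
    from quadratic_nonpos_linear_coeff_zero[OF this] show ?thesis
      by simp
  qed
  have "cinner x z = 0" if z: "z \<in> S" for z
  proof -
    have "\<i> *\<^sub>C z \<in> S"
      using z S by (simp add: complex_vector.subspace_scale)
    from inner0[OF this] inner0[OF z] show ?thesis
      by (simp add: inner_eq_Re_cinner cinner_simps complex_eq_iff)
  qed
  then show ?thesis
    by (simp add: orth_compl_def)
qed

text \<open>The nearest point of \<open>S\<close> serves. A minimizing sequence is Cauchy by the
  parallelogram law, and the first variation at its limit gives orthogonality.\<close>

lemma projection_exists:
  fixes S :: "'h::chilbert_space set"
  assumes "S \<in> Gr"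
  obtains y where "y \<in> S" "x - y \<in> orth_compl S"
proof -
  note S = Gr_subspace[OF assms]
  have "S \<noteq> {}"
    using complex_vector.subspace_0[OF S] by auto
  define d where "d = infdist x S"
  have d: "d \<le> norm (x - z)" if "z \<in> S" for z
    using infdist_le[OF that, of x] by (simp add: d_def dist_norm)
  have "d \<ge> 0"
    by (simp add: d_def infdist_nonneg)
  have "\<exists>z\<in>S. (norm (x - z))\<^sup>2 < d\<^sup>2 + 1 / real (Suc n)" for n
  proof -
    have "d < sqrt (d\<^sup>2 + 1 / real (Suc n))"
      using \<open>d \<ge> 0\<close> by (intro real_less_rsqrt) simp
    then obtain z where "z \<in> S" "dist x z < sqrt (d\<^sup>2 + 1 / real (Suc n))"
      using cInf_lessD[of "dist x ` S"] \<open>S \<noteq> {}\<close>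
      unfolding d_def infdist_notempty[OF \<open>S \<noteq> {}\<close>] by blast
    moreover from this have "(norm (x - z))\<^sup>2 < (sqrt (d\<^sup>2 + 1 / real (Suc n)))\<^sup>2"
      by (intro power_strict_mono) (auto simp: dist_norm)
    ultimately show ?thesis
      by auto
  qed
  then obtain y where y: "\<And>n. y n \<in> S" "\<And>n. (norm (x - y n))\<^sup>2 < d\<^sup>2 + 1 / real (Suc n)"
    by metis
  \<comment> \<open>The parallelogram law, combined with the fact that the midpoint of
    \<open>y i\<close> and \<open>y j\<close> is also at distance at least \<open>d\<close> from
    \<open>x\<close>.\<close>
  have diff: "(norm (y i - y j))\<^sup>2 \<le> 2 / real (Suc i) + 2 / real (Suc j)" for i j
  proof -
    have "(1/2) *\<^sub>R (y i + y j) \<in> S"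
      using y S by (simp add: scaleR_scaleC complex_vector.subspace_scale complex_vector.subspace_add)
    from power_mono[OF d[OF this] \<open>d \<ge> 0\<close>, of 2]
    have "4 * d\<^sup>2 \<le> 4 * (norm (x - (1/2) *\<^sub>R (y i + y j)))\<^sup>2"
      by simp
    also have "\<dots> = 2 * (norm (x - y i))\<^sup>2 + 2 * (norm (x - y j))\<^sup>2 - (norm (y i - y j))\<^sup>2"
      unfolding power2_norm_eq_inner
      by (simp add: inner_diff inner_add inner_commute[of "y _" x] inner_commute[of "y j" "y i"] algebra_simps)
    finally show ?thesis
      using y(2)[of i] y(2)[of j] by simp
  qed
  have "Cauchy y"
  proof (rule metric_CauchyI)
    fix r :: real assume "r > 0"
    obtain M where M: "inverse (real (Suc M)) < r\<^sup>2 / 4"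
      using reals_Archimedean[of "r\<^sup>2 / 4"] \<open>r > 0\<close> by auto
    have "dist (y i) (y j) < r" if "i \<ge> M" "j \<ge> M" for i j
    proof -
      have "1 / real (Suc i) \<le> 1 / real (Suc M)" "1 / real (Suc j) \<le> 1 / real (Suc M)"
        using that by (simp_all add: frac_le)
      then have "(norm (y i - y j))\<^sup>2 < r\<^sup>2"
        using diff[of i j] M by (simp add: inverse_eq_divide)
      then show ?thesis
        using \<open>r > 0\<close> by (simp add: dist_norm power_less_imp_less_base)
    qed
    then show "\<exists>M. \<forall>m\<ge>M. \<forall>n\<ge>M. dist (y m) (y n) < r"
      by blast
  qed
  then obtain z where z: "y \<longlonglongrightarrow> z"
    using Cauchy_convergent_iff convergent_def by blast
  have "z \<in> S"
    using closed_sequentially[OF _ _ z] assms y(1) by (auto simp: Gr_def)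
  have "(\<lambda>n. (norm (x - y n))\<^sup>2) \<longlonglongrightarrow> (norm (x - z))\<^sup>2"
    by (intro tendsto_intros z)
  moreover have "(\<lambda>n. d\<^sup>2 + 1 / real (Suc n)) \<longlonglongrightarrow> d\<^sup>2 + 0"
    using LIMSEQ_inverse_real_of_nat by (intro tendsto_intros) (simp add: inverse_eq_divide)
  moreover have "\<exists>N. \<forall>n\<ge>N. (norm (x - y n))\<^sup>2 \<le> d\<^sup>2 + 1 / real (Suc n)"
    using y(2) less_imp_le by blast
  ultimately have "(norm (x - z))\<^sup>2 \<le> d\<^sup>2 + 0"
    by (rule LIMSEQ_le)
  then have zd: "norm (x - z) \<le> d"
    using \<open>d \<ge> 0\<close> power2_le_imp_le[of "norm (x - z)" d] by simp
  have "x - z \<in> orth_compl S"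
  proof (rule orth_complI_minimal[OF S])
    fix s assume "s \<in> S"
    then have "d \<le> norm (x - (z + s))"
      using \<open>z \<in> S\<close> S by (intro d complex_vector.subspace_add)
    then show "norm (x - z) \<le> norm (x - z - s)"
      using zd by (simp add: diff_diff_eq)
  qed
  with \<open>z \<in> S\<close> show thesis
    by (rule that)
qed

lemma orth_proj_mem:
  assumes "S \<in> Gr"
  shows "orth_proj S x \<in> S" "x - orth_proj S x \<in> orth_compl S"
proof -
  obtain y where y: "y \<in> S" "x - y \<in> orth_compl S"
    using projection_exists[OF assms] .
  moreover have "orth_proj S x = y"
    by (rule orth_proj_eqI[OF Gr_subspace[OF assms] y])
  ultimately show "orth_proj S x \<in> S" "x - orth_proj S x \<in> orth_compl S"
    by simp_all
qed

lemma inner_orth_compl: "y \<in> S \<Longrightarrow> x \<in> orth_compl S \<Longrightarrow> inner x y = 0"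
  by (simp add: orth_compl_def inner_eq_Re_cinner)

lemma inner_orth_proj:
  assumes "S \<in> Gr"
  shows "inner (orth_proj S x) x = (norm (orth_proj S x))\<^sup>2"
    and "(norm x)\<^sup>2 = (norm (orth_proj S x))\<^sup>2 + (norm (x - orth_proj S x))\<^sup>2"
proof -
  have "inner (x - orth_proj S x) (orth_proj S x) = 0"
    using orth_proj_mem[OF assms] inner_orth_compl by blast
  then show "inner (orth_proj S x) x = (norm (orth_proj S x))\<^sup>2"
    "(norm x)\<^sup>2 = (norm (orth_proj S x))\<^sup>2 + (norm (x - orth_proj S x))\<^sup>2"
    by (simp_all add: power2_norm_eq_inner inner_diff inner_commute algebra_simps)
qed

lemma bounded_linear_orth_proj:
  assumes "S \<in> Gr"
  shows "bounded_linear (orth_proj S)"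
proof (rule bounded_linear_intro[of _ 1])
  note S = Gr_subspace[OF assms]
  fix x y :: 'a and r :: real
  have "x + y - (orth_proj S x + orth_proj S y) \<in> orth_compl S"
    using complex_vector.subspace_add[OF subspace_orth_compl orth_proj_mem(2)[OF assms, of x]
        orth_proj_mem(2)[OF assms, of y]] by (simp add: algebra_simps)
  then show "orth_proj S (x + y) = orth_proj S x + orth_proj S y"
    by (intro orth_proj_eqI[OF S] complex_vector.subspace_add[OF S] orth_proj_mem[OF assms])
  have "r *\<^sub>R x - r *\<^sub>R orth_proj S x \<in> orth_compl S"
    using complex_vector.subspace_scale[OF subspace_orth_compl orth_proj_mem(2)[OF assms, of x], of r]
    by (simp add: scaleR_scaleC complex_vector.scale_right_diff_distrib)
  then show "orth_proj S (r *\<^sub>R x) = r *\<^sub>R orth_proj S x"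
    using complex_vector.subspace_scale[OF S orth_proj_mem(1)[OF assms, of x], of r]
    by (intro orth_proj_eqI[OF S]) (simp_all add: scaleR_scaleC)
  have "(norm (orth_proj S x))\<^sup>2 \<le> (norm x)\<^sup>2"
    using inner_orth_proj(2)[OF assms, of x] by simp
  then show "norm (orth_proj S x) \<le> norm x * 1"
    by simp
qed

lemma proj_curve_apply: "\<gamma> t \<in> Gr \<Longrightarrow> blinfun_apply (proj_curve \<gamma> t) = orth_proj (\<gamma> t)"
  by (simp add: proj_curve_def bounded_linear_Blinfun_apply bounded_linear_orth_proj)

text \<open>
  With \<open>u = P x\<close> and \<open>v = x - P x\<close>, the functions \<open>s \<mapsto> \<langle>P(s) u, u\<rangle>\<close> and \<open>s \<mapsto> \<langle>P(s) v, v\<rangle>\<close> have an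
  extremum at \<open>t\<close>, so only the mixed terms contribute to the derivative.
\<close>

lemma proj_curve_derivative_bound:
  assumes Gr: "\<And>s. s \<in> {a<..<b} \<Longrightarrow> \<gamma> s \<in> Gr" and t: "t \<in> {a<..<b}"
    and D: "(proj_curve \<gamma> has_vector_derivative D) (at t)"
  shows "\<bar>inner (D x) x\<bar> \<le> 2 * norm D * (norm (orth_proj (\<gamma> t) x) * norm (x - orth_proj (\<gamma> t) x))"
proof -
  have deriv: "((\<lambda>s. inner (proj_curve \<gamma> s y) y) has_real_derivative inner (D y) y) (at t)" for y
  proof -
    have "bounded_linear (\<lambda>B. inner (blinfun_apply B y) y)"
      by (intro bounded_linear_intros)
    from bounded_linear.has_vector_derivative[OF this D] show ?thesis
      by (simp add: has_real_derivative_iff_has_vector_derivative)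
  qed
  define u where "u = orth_proj (\<gamma> t) x"
  define v where "v = x - u"
  note G = Gr[OF t]
  have u: "orth_proj (\<gamma> t) u = u"
    using orth_proj_mem(1)[OF G, of x] complex_vector.subspace_0[OF subspace_orth_compl]
    by (intro orth_proj_eqI[OF Gr_subspace[OF G]]) (simp_all add: u_def)
  have v: "orth_proj (\<gamma> t) v = 0"
    using orth_proj_mem(2)[OF G, of x] complex_vector.subspace_0[OF Gr_subspace[OF G]]
    by (intro orth_proj_eqI[OF Gr_subspace[OF G]]) (simp_all add: u_def v_def)
  obtain e where e: "e > 0" "{t - e<..<t + e} \<subseteq> {a<..<b}"
  proof
    show "min (t - a) (b - t) > 0" "{t - min (t - a) (b - t)<..<t + min (t - a) (b - t)} \<subseteq> {a<..<b}"
      using t by auto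
  qed
  have Gr_near: "\<gamma> s \<in> Gr" if "\<bar>t - s\<bar> < e" for s
  proof -
    have "s \<in> {t - e<..<t + e}"
      using that by auto
    then show ?thesis
      using e(2) Gr by blast
  qed
  have "inner (D u) u = 0"
  proof (rule DERIV_local_max[OF deriv e(1)], intro allI impI)
    fix s assume "\<bar>t - s\<bar> < e"
    then have "inner (proj_curve \<gamma> s u) u \<le> (norm u)\<^sup>2"
      using inner_orth_proj[OF Gr_near, of s u] by (simp add: proj_curve_apply[of \<gamma> s] Gr_near)
    then show "inner (proj_curve \<gamma> s u) u \<le> inner (proj_curve \<gamma> t u) u"
      by (simp add: proj_curve_apply[of \<gamma> t] G u power2_norm_eq_inner)
  qed
  moreover have "inner (D v) v = 0"
  proof (rule DERIV_local_min[OF deriv e(1)], intro allI impI)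
    fix s assume "\<bar>t - s\<bar> < e"
    then show "inner (proj_curve \<gamma> t v) v \<le> inner (proj_curve \<gamma> s v) v"
      using inner_orth_proj[OF Gr_near, of s v]
      by (simp add: proj_curve_apply[of \<gamma> s] Gr_near proj_curve_apply[of \<gamma> t] G v)
  qed
  moreover have "x = u + v"
    by (simp add: v_def)
  ultimately have "inner (D x) x = inner (D u) v + inner (D v) u"
    by (simp add: blinfun.add_right inner_add)
  moreover have "\<bar>inner (D y) z\<bar> \<le> norm D * (norm y * norm z)" for y z
    using order_trans[OF Cauchy_Schwarz_ineq2[of "D y" z] mult_right_mono[OF norm_blinfun[of D y]]]
    by (simp add: mult.assoc)
  from this[of u v] this[of v u] have "\<bar>inner (D u) v + inner (D v) u\<bar> \<le> 2 * norm D * (norm u * norm v)"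
    by (simp add: mult.commute[of "norm v"])
  ultimately show ?thesis
    by (simp add: u_def v_def)
qed

text \<open>
  If \<open>\<theta>\<close> is the angle between \<open>x\<close> and \<open>\<gamma> t\<close> then \<open>cos (2 \<theta>) = 2 \<parallel>P x\<parallel>\<^sup>2 - 1\<close>, and \<open>\<theta>\<close> moves at most as fast
  as \<open>\<gamma>\<close>. The factor \<open>r < 1\<close> keeps the argument of \<open>arccos\<close> away from its singularities.
\<close>

lemma Gr_curve_angle_le_length:
  assumes \<gamma>: "Gr_curve_joining S T \<gamma>" and x: "x \<in> S" "norm x = 1"
  shows "arccos (2 * (norm (orth_proj T x))\<^sup>2 - 1) \<le> 2 * curve_length \<gamma>"
proof -
  have Gr: "\<gamma> t \<in> Gr" if "t \<in> {0..1}" for t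
    using \<gamma> that by (simp add: Gr_curve_joining_def)
  have ends: "\<gamma> 0 = S" "\<gamma> 1 = T"
    using \<gamma> by (simp_all add: Gr_curve_joining_def)
  have cont: "continuous_on {0..1} (proj_curve \<gamma>)" and int: "speed \<gamma> integrable_on {0..1}"
    using \<gamma> by (simp_all add: Gr_curve_joining_def piecewise_C1_differentiable_on_def)
  obtain F where F: "finite F" "proj_curve \<gamma> C1_differentiable_on ({0..1} - F)"
    using \<gamma> by (auto simp: Gr_curve_joining_def piecewise_C1_differentiable_on_def)
  then obtain D where D: "\<And>t. t \<in> {0..1} - F \<Longrightarrow> (proj_curve \<gamma> has_vector_derivative D t) (at t)"
    unfolding C1_differentiable_on_def by blast
  define h where "h t = inner (proj_curve \<gamma> t x) x" for t
  define y where "y t = 2 * h t - 1" for t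
  have h: "h t = (norm (orth_proj (\<gamma> t) x))\<^sup>2"
    "1 - h t = (norm (x - orth_proj (\<gamma> t) x))\<^sup>2" if "t \<in> {0..1}" for t
    using inner_orth_proj[OF Gr[OF that], of x] x
    by (simp_all add: h_def proj_curve_apply[of \<gamma> t] Gr[OF that])
  have y_bound: "\<bar>y t\<bar> \<le> 1" if "t \<in> {0..1}" for t
  proof -
    have "0 \<le> h t" "0 \<le> 1 - h t"
      unfolding h(2)[OF that] unfolding h(1)[OF that] by simp_all
    then show ?thesis
      by (simp add: y_def abs_le_iff)
  qed
  have h_cont: "continuous_on {0..1} h"
    unfolding h_def by (intro continuous_intros cont)
  have h_deriv: "(h has_real_derivative inner (D t x) x) (at t)" if "t \<in> {0..1} - F" for t
  proof -
    have "bounded_linear (\<lambda>B. inner (blinfun_apply B x) x)"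
      by (intro bounded_linear_intros)
    from bounded_linear.has_vector_derivative[OF this D[OF that]] show ?thesis
      by (simp add: has_real_derivative_iff_has_vector_derivative h_def[abs_def])
  qed
  have bound: "2 * \<bar>inner (D t x) x\<bar> \<le> 2 * speed \<gamma> t * sqrt (1 - (y t)\<^sup>2)" if "t \<in> {0<..<1} - F" for t
  proof -
    \<comment> \<open>The double-angle formula for the sine, with the two norms as cosine and sine
      of the angle between \<open>x\<close> and the subspace.\<close>
    have "sqrt (1 - (y t)\<^sup>2) = 2 * (norm (orth_proj (\<gamma> t) x) * norm (x - orth_proj (\<gamma> t) x))"
    proof (rule real_sqrt_unique)
      have "(2 * (norm (orth_proj (\<gamma> t) x) * norm (x - orth_proj (\<gamma> t) x)))\<^sup>2 = 4 * (h t * (1 - h t))"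
        using that by (simp add: power_mult_distrib h(2) flip: h(1))
      then show "(2 * (norm (orth_proj (\<gamma> t) x) * norm (x - orth_proj (\<gamma> t) x)))\<^sup>2 = 1 - (y t)\<^sup>2"
        by (simp add: y_def power2_eq_square algebra_simps)
    qed simp
    moreover have "speed \<gamma> t = norm (D t)"
      using vector_derivative_at[OF D] that by (simp add: speed_def)
    ultimately show ?thesis
      using proj_curve_derivative_bound[of 0 1 \<gamma> t "D t" x] Gr D that by simp
  qed
  have regular: "arccos (r * y 1) - arccos (r * y 0) \<le> 2 * curve_length \<gamma>" if r: "0 < r" "r < 1" for r
  proof -
    \<comment> \<open>The derivative of \<open>arccos (r * y t)\<close>, with value 0 at the ends
      and at the finitely many break points, where the fundamental theorem only needs continuity of
      the antiderivative.\<close>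
    define \<psi> where "\<psi> t = (if t \<in> {0<..<1} - F
      then - (2 * r * inner (D t x) x) / sqrt (1 - (r * y t)\<^sup>2) else 0)" for t
    have ry: "\<bar>r * y t\<bar> < 1" if "t \<in> {0..1}" for t
    proof -
      have "r * \<bar>y t\<bar> \<le> r * 1"
        using y_bound[OF that] r by (intro mult_left_mono) auto
      moreover have "\<bar>r * y t\<bar> = r * \<bar>y t\<bar>"
        using r by (simp add: abs_mult)
      ultimately show ?thesis
        using r by linarith
    qed
    have "(\<psi> has_integral arccos (r * y 1) - arccos (r * y 0)) {0..1}"
    proof (rule fundamental_theorem_of_calculus_interior_strong[OF F(1)])
      fix t assume t: "t \<in> {0<..<1} - F"
      have "((\<lambda>t. arccos (r * y t)) has_real_derivative \<psi> t) (at t)"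
        unfolding y_def using t ry[of t] h_deriv[of t]
        by (auto intro!: derivative_eq_intros simp: \<psi>_def y_def abs_less_iff divide_inverse)
      then show "((\<lambda>t. arccos (r * y t)) has_vector_derivative \<psi> t) (at t)"
        by (simp add: has_real_derivative_iff_has_vector_derivative)
    next
      show "continuous_on {0..1} (\<lambda>t. arccos (r * y t))"
        unfolding y_def using ry
        by (intro continuous_intros h_cont ballI) (auto simp: y_def abs_less_iff less_imp_le)
    qed simp
    moreover have "((\<lambda>t. 2 * speed \<gamma> t) has_integral 2 * curve_length \<gamma>) {0..1}"
      unfolding curve_length_def by (intro has_integral_mult_right integrable_integral int)
    ultimately show ?thesis
    proof (rule has_integral_le)
      fix t :: real
      have sp: "0 \<le> speed \<gamma> t"
        by (simp add: speed_def)
      show "\<psi> t \<le> 2 * speed \<gamma> t"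
      proof (cases "t \<in> {0<..<1} - F")
        case True
        have pos: "0 < sqrt (1 - (r * y t)\<^sup>2)"
          using ry[of t] True by (simp add: abs_square_less_1)
        \<comment> \<open>Shrinking \<open>y\<close> by \<open>r\<close> only enlarges the square
          root, so the bound for \<open>y\<close> carries over to \<open>r * y\<close>.\<close>
        have "(r * y t)\<^sup>2 \<le> (y t)\<^sup>2"
          using r by (simp add: power_mult_distrib mult_left_le_one_le power_le_one)
        then have "sqrt (1 - (y t)\<^sup>2) \<le> sqrt (1 - (r * y t)\<^sup>2)"
          by simp
        from mult_left_mono[OF this, of "2 * speed \<gamma> t"] sp bound[OF True]
        have "2 * \<bar>inner (D t x) x\<bar> \<le> 2 * speed \<gamma> t * sqrt (1 - (r * y t)\<^sup>2)"
          by simp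
        moreover have "- (2 * r * inner (D t x) x) \<le> 2 * \<bar>inner (D t x) x\<bar>"
        proof -
          have "r * \<bar>inner (D t x) x\<bar> \<le> 1 * \<bar>inner (D t x) x\<bar>"
            using r by (intro mult_right_mono) auto
          moreover have "- (r * inner (D t x) x) \<le> r * \<bar>inner (D t x) x\<bar>"
            using r by (metis abs_ge_minus_self abs_mult abs_of_pos)
          ultimately show ?thesis
            by simp
        qed
        ultimately show ?thesis
          unfolding \<psi>_def if_P[OF True] pos_divide_le_eq[OF pos] by linarith
      next
        case False
        then show ?thesis
          using sp by (simp only: \<psi>_def if_False)
      qed
    qed
  qed
  have "x - x \<in> orth_compl S"
    using complex_vector.subspace_0[OF subspace_orth_compl] by simp
  then have "orth_proj S x = x"
    using Gr[of 0] x ends by (intro orth_proj_eqI Gr_subspace) auto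
  then have y0: "y 0 = 1"
    using h(1)[of 0] x ends by (simp add: y_def)
  have "\<bar>r * y 1\<bar> \<le> 1" if "r \<in> {0..1}" for r
    using that y_bound[of 1] by (simp add: abs_mult mult_le_one)
  then have "- 1 \<le> r * y 1 \<and> r * y 1 \<le> 1" if "r \<in> {0..1}" for r
    using that by (metis abs_le_D1 abs_le_D2 minus_le_iff)
  \<comment> \<open>Both sides of \<open>regular\<close> are continuous in \<open>r\<close> up to
    the ends, so the estimate survives the limit \<open>r = 1\<close>, where \<open>y 0 = 1\<close>
    contributes \<open>arccos 1 = 0\<close>.\<close>
  then have "continuous_on {0..1} (\<lambda>r. arccos (r * y 1) - arccos r)"
    by (intro continuous_intros) auto
  then have "arccos (1 * y 1) - arccos 1 \<le> 2 * curve_length \<gamma>"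
    using continuous_le_on_closure[of "{0<..<1}" "\<lambda>r. arccos (r * y 1) - arccos r" 1 "2 * curve_length \<gamma>"]
      regular y0 by simp
  then show ?thesis
    using h(1)[of 1] ends by (simp add: y_def)
qed

section \<open>Length of a rotation\<close>

lemma norm_le_of_sq:
  assumes "(norm x)\<^sup>2 \<le> (c * norm y)\<^sup>2" "0 \<le> c"
  shows "norm x \<le> c * norm y"
  using assms power2_le_imp_le[of "norm x" "c * norm y"] by simp

section \<open>Rank-one operators as building blocks of the curve of projections\<close>

definition rank_one :: "'h::complex_inner \<Rightarrow> 'h \<Rightarrow> 'h \<Rightarrow>\<^sub>L 'h" where
  "rank_one a b = Blinfun (\<lambda>x. cinner x a *\<^sub>C b)"

lemma rank_one_apply [simp]: "blinfun_apply (rank_one a b) x = cinner x a *\<^sub>C b"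
proof -
  have "bounded_linear (\<lambda>x. cinner x a *\<^sub>C b)"
    by (rule bounded_linear_compose[OF bounded_bilinear.bounded_linear_left[OF bounded_bilinear_scaleC]
        bounded_linear_cinner_left])
  then show ?thesis
    by (simp add: rank_one_def bounded_linear_Blinfun_apply)
qed

text \<open>The dependence on \<open>a\<close> is conjugate linear; real bilinearity is what the
  product rule for derivatives in a real parameter asks for.\<close>

lemma bounded_bilinear_rank_one: "bounded_bilinear rank_one"
proof
  fix a a' b b' :: 'a and r :: real
  show "rank_one (a + a') b = rank_one a b + rank_one a' b"
    by (rule blinfun_eqI) (simp add: blinfun.add_left cinner_add_right scaleC_add_left)
  show "rank_one a (b + b') = rank_one a b + rank_one a b'"
    by (rule blinfun_eqI) (simp add: blinfun.add_left scaleC_add_right)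
  show "rank_one (r *\<^sub>R a) b = r *\<^sub>R rank_one a b"
    by (rule blinfun_eqI) (simp add: blinfun.scaleR_left cinner_simps scaleR_scaleC scaleC_scaleC)
  show "rank_one a (r *\<^sub>R b) = r *\<^sub>R rank_one a b"
    by (rule blinfun_eqI) (simp add: blinfun.scaleR_left scaleC_scaleR)
  have "norm (rank_one a b) \<le> norm a * norm b" for a b :: 'a
  proof (rule norm_blinfun_bound)
    fix x
    have "norm (cinner x a) * norm b \<le> norm x * norm a * norm b"
      by (intro mult_right_mono norm_cinner_le) simp
    then show "norm (blinfun_apply (rank_one a b) x) \<le> norm a * norm b * norm x"
      by (simp add: mult_ac)
  qed simp
  then show "\<exists>K. \<forall>a b::'a. norm (rank_one a b) \<le> norm a * norm b * K"
    by (metis mult.right_neutral)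
qed

context frame
begin

text \<open>This turns out to be the constant speed of the rotation. Inserting 0 covers
  \<open>m = 0\<close> and does not affect the maximum otherwise, the \<open>l i\<close> being
  nonnegative.\<close>

definition max_angle :: real where "max_angle = Max (insert 0 (l ` {..<m}))"

lemma max_angle_ge: "i < m \<Longrightarrow> l i \<le> max_angle" and max_angle_nonneg: "0 \<le> max_angle"
  by (simp_all add: max_angle_def)

lemma max_angle_le: "0 \<le> c \<Longrightarrow> (\<And>i. i < m \<Longrightarrow> l i \<le> c) \<Longrightarrow> max_angle \<le> c"
  by (auto simp: max_angle_def)

lemma max_angle_attained: "max_angle = 0 \<or> (\<exists>j<m. l j = max_angle)"
  using Max_in[of "insert 0 (l ` {..<m})"] by (auto simp: max_angle_def)

text \<open>Pythagoras; in a degenerate plane \<open>g i\<close> is 0 and not a unit vector, hence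
  the condition on \<open>b i\<close>.\<close>

lemma norm_combination:
  assumes b: "\<And>i. i < m \<Longrightarrow> l i = 0 \<Longrightarrow> b i = 0"
  shows "(norm (\<Sum>i<m. a i *\<^sub>C e i + b i *\<^sub>C g i))\<^sup>2 = (\<Sum>i<m. (norm (a i))\<^sup>2 + (norm (b i))\<^sup>2)"
proof -
  define y where "y = (\<Sum>i<m. a i *\<^sub>C e i + b i *\<^sub>C g i)"
  have ye: "cinner y (e j) = a j" and yg: "cinner y (g j) = b j" if j: "j < m" for j
  proof -
    have "cinner y (e j) = (\<Sum>i<m. a i * of_bool (i = j))"
      unfolding y_def cinner_simps using j by (intro sum.cong) (auto simp: ee ge)
    then show "cinner y (e j) = a j"
      by (simp only: sum_of_bool_eq[OF j])
    have "cinner y (g j) = (\<Sum>i<m. b i * of_bool (i = j))"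
      unfolding y_def cinner_simps using j b by (intro sum.cong) (auto simp: eg gg)
    then show "cinner y (g j) = b j"
      by (simp only: sum_of_bool_eq[OF j])
  qed
  have "complex_of_real ((norm y)\<^sup>2) = cinner y (\<Sum>i<m. a i *\<^sub>C e i + b i *\<^sub>C g i)"
    unfolding cinner_self[symmetric] by (simp add: y_def)
  also have "\<dots> = (\<Sum>i<m. complex_of_real ((norm (a i))\<^sup>2 + (norm (b i))\<^sup>2))"
    unfolding cinner_simps
  proof (rule sum.cong[OF refl])
    fix i assume "i \<in> {..<m}"
    then show "cnj (a i) * cinner y (e i) + cnj (b i) * cinner y (g i) =
        complex_of_real ((norm (a i))\<^sup>2 + (norm (b i))\<^sup>2)"
      by (simp add: ye yg complex_norm_square mult.commute flip: of_real_power)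
  qed
  finally show ?thesis
    unfolding y_def of_real_sum[symmetric] of_real_eq_iff .
qed

lemma bessel: "(\<Sum>i<m. (norm (cinner x (e i)))\<^sup>2 + (norm (cinner x (g i)))\<^sup>2) \<le> (norm x)\<^sup>2"
proof -
  define y where "y = (\<Sum>i<m. p x i)"
  have "(norm y)\<^sup>2 = (\<Sum>i<m. (norm (cinner x (e i)))\<^sup>2 + (norm (cinner x (g i)))\<^sup>2)"
    unfolding y_def p_def by (rule norm_combination) (simp add: g_zero)
  moreover have "cinner (x - y) y = 0"
    unfolding y_def p_def cinner_sum_right cinner_add_right cinner_scaleC_right
    unfolding p_def[symmetric] by (intro sum.neutral) (simp add: cinner_diff_left cinner_sum_p)
  then have "inner (x - y) y = 0"
    by (simp add: inner_eq_Re_cinner)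
  then have "(norm x)\<^sup>2 = (norm y)\<^sup>2 + (norm (x - y))\<^sup>2"
    by (simp add: power2_norm_eq_inner inner_diff inner_commute algebra_simps)
  ultimately show ?thesis
    by simp
qed

text \<open>Minus the derivative at time 0 of the projection onto the rotating complement;
  \<open>proj_path_deriv\<close> uses it for the frame at time \<open>t\<close>.\<close>

definition vel :: "'h \<Rightarrow>\<^sub>L 'h" where
  "vel = (\<Sum>i<m. l i *\<^sub>R (rank_one (g i) (e i) + rank_one (e i) (g i)))"

lemma vel_apply:
  "blinfun_apply vel x = (\<Sum>i<m. (complex_of_real (l i) * cinner x (g i)) *\<^sub>C e i +
     (complex_of_real (l i) * cinner x (e i)) *\<^sub>C g i)"
  by (simp add: vel_def blinfun.sum_left blinfun.scaleR_left blinfun.add_left scaleR_scaleC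
      scaleC_add_right scaleC_scaleC)

text \<open>In each of the mutually orthogonal planes \<open>vel\<close> exchanges
  \<open>e i\<close> and \<open>g i\<close> with factor \<open>l i\<close>. Bessel's inequality
  gives the upper bound, and the vector \<open>e j\<close> of a fastest plane attains it.\<close>

lemma norm_vel: "norm vel = max_angle"
proof (rule antisym)
  show "norm vel \<le> max_angle"
  proof (rule norm_blinfun_bound[OF max_angle_nonneg])
    fix x
    have "(norm (vel x))\<^sup>2 =
        (\<Sum>i<m. (l i)\<^sup>2 * ((norm (cinner x (e i)))\<^sup>2 + (norm (cinner x (g i)))\<^sup>2))"
      unfolding vel_apply by (subst norm_combination) (auto simp: norm_mult power_mult_distrib algebra_simps)
    also have "\<dots> \<le> (\<Sum>i<m. max_angle\<^sup>2 * ((norm (cinner x (e i)))\<^sup>2 + (norm (cinner x (g i)))\<^sup>2))"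
      by (intro sum_mono mult_right_mono power_mono) (auto simp: max_angle_ge l_nonneg)
    also have "\<dots> \<le> max_angle\<^sup>2 * (norm x)\<^sup>2"
      unfolding sum_distrib_left[symmetric] by (intro mult_left_mono bessel) simp
    finally show "norm (vel x) \<le> max_angle * norm x"
      by (intro norm_le_of_sq[OF _ max_angle_nonneg]) (simp add: power_mult_distrib)
  qed
  show "max_angle \<le> norm vel"
    using max_angle_attained
  proof
    assume "\<exists>j<m. l j = max_angle"
    then obtain j where j: "j < m" "l j = max_angle"
      by blast
    show ?thesis
    proof (cases "l j = 0")
      case False
      have "vel (e j) = (\<Sum>i\<in>{j}. complex_of_real (l i) *\<^sub>C g i)"
        unfolding vel_apply using j by (intro sum.mono_neutral_cong_right) (auto simp: ee eg)
      then have "norm (vel (e j)) = l j * norm (g j)"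
        using l_nonneg[OF j(1)] by simp
      moreover have "norm (g j) = 1" "norm (e j) = 1"
        using gg[OF j(1) j(1)] ee[OF j(1) j(1)] False by (simp_all add: cinner_self_eq_1_iff)
      ultimately show ?thesis
        using norm_blinfun[of vel "e j"] j by simp
    qed (use j in simp)
  qed simp
qed

definition proj_path :: "real \<Rightarrow> 'h \<Rightarrow>\<^sub>L 'h" where
  "proj_path t = id_blinfun - (\<Sum>i<m. rank_one (u t i) (u t i))"

lemma onb_u: "onb m (u t) (complex_vector.span (u t ` {..<m}))"
  using frame.ee[OF frame_rot[of t]] by (simp add: onb_def)

lemma proj_path_apply: "blinfun_apply (proj_path t) x = x - fproj m (u t) x"
  by (simp add: proj_path_def fproj_def blinfun.diff_left blinfun.sum_left)

lemma orth_proj_u: "orth_proj (orth_compl (u t ` {..<m})) x = x - fproj m (u t) x"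
proof (rule orth_proj_eqI[OF subspace_orth_compl])
  show "x - fproj m (u t) x \<in> orth_compl (u t ` {..<m})"
    using fproj_orth[OF onb_u] orth_compl_span by blast
  show "x - (x - fproj m (u t) x) \<in> orth_compl (orth_compl (u t ` {..<m}))"
    using fproj_mem[OF onb_u, of t x] onb_orth_compl_orth_compl[OF onb_u[of t]]
    by (simp add: orth_compl_span)
qed

lemma proj_curve_eq_proj_path:
  assumes "\<delta> t = orth_compl (u t ` {..<m})"
  shows "proj_curve \<delta> t = proj_path t"
  by (rule blinfun_eqI) (simp add: assms proj_curve_apply orth_compl_in_Gr orth_proj_u proj_path_apply)

lemma u_deriv: "((\<lambda>t. u t i) has_vector_derivative l i *\<^sub>R w t i) (at t)"
  unfolding rot_e_def rot_g_def
  by (auto intro!: derivative_eq_intros simp: algebra_simps)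

lemma proj_path_deriv: "(proj_path has_vector_derivative - frame.vel m (u t) (w t) l) (at t)"
proof -
  interpret R: frame m "u t" "w t" l
    by (rule frame_rot)
  have "((\<lambda>t. id_blinfun - (\<Sum>i<m. rank_one (u t i) (u t i))) has_vector_derivative
      0 - (\<Sum>i<m. rank_one (u t i) (l i *\<^sub>R w t i) + rank_one (l i *\<^sub>R w t i) (u t i))) (at t)"
    by (intro has_vector_derivative_diff has_vector_derivative_const has_vector_derivative_sum
        bounded_bilinear.has_vector_derivative[OF bounded_bilinear_rank_one] u_deriv)
  moreover have "0 - (\<Sum>i<m. rank_one (u t i) (l i *\<^sub>R w t i) + rank_one (l i *\<^sub>R w t i) (u t i)) = - R.vel"
    by (simp add: R.vel_def bounded_bilinear.scaleR_left[OF bounded_bilinear_rank_one]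
        bounded_bilinear.scaleR_right[OF bounded_bilinear_rank_one] scaleR_add_right add.commute)
  ultimately show ?thesis
    by (simp add: proj_path_def[abs_def])
qed

lemma continuous_vel: "continuous_on S (\<lambda>t. frame.vel m (u t) (w t) l)"
proof -
  have "continuous_on S (\<lambda>t. \<Sum>i<m. l i *\<^sub>R (rank_one (w t i) (u t i) + rank_one (u t i) (w t i)))"
    unfolding rot_e_def rot_g_def
    by (intro continuous_intros bounded_bilinear.continuous_on[OF bounded_bilinear_rank_one])
  then show ?thesis
    using frame.vel_def[OF frame_rot] by presburger
qed

text \<open>Restricted to interior times because \<open>speed\<close> takes a two-sided derivative,
  which at 0 and 1 also sees the values of \<open>\<delta>\<close> outside the interval.\<close>

lemma speed_path:
  assumes "\<And>t. t \<in> {0..1} \<Longrightarrow> \<delta> t = orth_compl (u t ` {..<m})" and t: "t \<in> {0<..<1}"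
  shows "speed \<delta> t = max_angle"
proof -
  interpret R: frame m "u t" "w t" l
    by (rule frame_rot)
  have "(proj_curve \<delta> has_vector_derivative - R.vel) (at t)"
    using proj_path_deriv
  proof (rule has_vector_derivative_transform_within_open)
    show "proj_path s = proj_curve \<delta> s" if "s \<in> {0<..<1}" for s
      using that assms(1) by (intro proj_curve_eq_proj_path[symmetric]) auto
  qed (use t in auto)
  then have "speed \<delta> t = norm R.vel"
    by (simp add: speed_def vector_derivative_at)
  then show ?thesis
    by (simp add: R.norm_vel R.max_angle_def max_angle_def)
qed

lemma has_integral_speed_path:
  assumes "\<And>t. t \<in> {0..1} \<Longrightarrow> \<delta> t = orth_compl (u t ` {..<m})"
  shows "(speed \<delta> has_integral max_angle) {0..1}"
proof (rule has_integral_spike_finite[of "{0, 1}"])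
  show "((\<lambda>_::real. max_angle) has_integral max_angle) {0..1}"
    using has_integral_const_real[of max_angle 0 1] by simp
  show "speed \<delta> t = max_angle" if "t \<in> {0..1} - {0, 1}" for t
    using that by (intro speed_path assms) auto
qed auto

lemma curve_length_path:
  assumes "\<And>t. t \<in> {0..1} \<Longrightarrow> \<delta> t = orth_compl (u t ` {..<m})"
  shows "curve_length \<delta> = max_angle"
  unfolding curve_length_def by (rule integral_unique[OF has_integral_speed_path[OF assms]])

abbreviation path :: "real \<Rightarrow> 'h set" where "path t \<equiv> orth_compl (u t ` {..<m})"

lemma u_0: "u 0 i = e i"
  by (simp add: rot_e_def)

text \<open>Makes a rotation an admissible competitor in the comparison of lengths in
  \<open>minimal_normal_form\<close>.\<close>

lemma Gr_curve_path: "Gr_curve_joining (path 0) (path 1) path"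
proof -
  have eq: "proj_curve path = proj_path"
    by (intro ext proj_curve_eq_proj_path) simp
  have "proj_path C1_differentiable_on {0..1} - {}"
    unfolding C1_differentiable_on_def using proj_path_deriv continuous_vel[THEN continuous_on_minus]
    by (intro exI[of _ "\<lambda>t. - frame.vel m (u t) (w t) l"]) blast
  moreover have "continuous_on {0..1} proj_path"
    using proj_path_deriv by (intro continuous_at_imp_continuous_on ballI has_vector_derivative_continuous)
  ultimately have "proj_path piecewise_C1_differentiable_on {0..1}"
    unfolding piecewise_C1_differentiable_on_def by blast
  then show ?thesis
    using has_integral_speed_path[of path] eq
    by (auto simp: Gr_curve_joining_def orth_compl_in_Gr integrable_on_def)
qed

lemma path_0: "path 0 = orth_compl (e ` {..<m})"
  by (simp add: u_0)

lemma geodesic_path: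
  assumes "\<And>t. t \<in> {0..1} \<Longrightarrow> \<delta> t = path t"
  shows "geodesic_joining (path 0) (path 1) \<delta>"
  unfolding geodesic_joining_def
proof (intro conjI exI[of _ op] ballI)
  show "\<delta> t = op_exp (\<lambda>x. (\<i> * complex_of_real t) *\<^sub>C op x) ` path 0" if "t \<in> {0..1}" for t
    using assms[OF that] op_exp_op_image[of t] by (simp add: path_0)
  show "op_exp (\<lambda>x. \<i> *\<^sub>C op x) ` path 0 = path 1"
    using op_exp_op_image[of 1] by (simp add: path_0)
  show "codiagonal (path 0) op"
    using op_codiagonal by (simp add: path_0)
qed (simp_all add: orth_compl_in_Gr op_bounded_clinear op_selfadjoint)

text \<open>The vector \<open>g j\<close> of a fastest plane lies in \<open>path 0\<close> and forms
  the angle \<open>l j\<close> with \<open>path 1\<close>, so every competing curve must turn by at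
  least this angle.\<close>

lemma max_angle_le_length:
  assumes \<gamma>: "Gr_curve_joining (path 0) (path 1) \<gamma>" and le: "max_angle \<le> pi / 2"
  shows "max_angle \<le> curve_length \<gamma>"
proof (cases "max_angle = 0")
  case True
  have "speed \<gamma> integrable_on {0..1}"
    using \<gamma> by (simp add: Gr_curve_joining_def)
  then have "0 \<le> curve_length \<gamma>"
    unfolding curve_length_def by (rule integral_nonneg) (simp add: speed_def)
  then show ?thesis
    using True by simp
next
  case False
  then obtain j where j: "j < m" "l j = max_angle"
    using max_angle_attained by blast
  have gj: "g j \<in> path 0" "norm (g j) = 1"
    using j False gg[OF j(1) j(1)] by (auto simp: u_0 orth_compl_def ge cinner_self_eq_1_iff)
  have "(norm (orth_proj (path 1) (g j)))\<^sup>2 = (cos (l j))\<^sup>2"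
  proof -
    interpret R: frame m "u 1" "w 1" l
      by (rule frame_rot)
    have "g j = sin (l j) *\<^sub>R u 1 j + cos (l j) *\<^sub>R w 1 j"
      using rot_g_back[of 1 l j e g] by simp
    moreover have "orth_proj (path 1) (sin (l j) *\<^sub>R u 1 j + cos (l j) *\<^sub>R w 1 j) = cos (l j) *\<^sub>R w 1 j"
    proof (rule orth_proj_eqI[OF subspace_orth_compl])
      show "cos (l j) *\<^sub>R w 1 j \<in> path 1"
        using j by (auto simp: orth_compl_def cinner_simps R.ge)
      show "sin (l j) *\<^sub>R u 1 j + cos (l j) *\<^sub>R w 1 j - cos (l j) *\<^sub>R w 1 j \<in> orth_compl (path 1)"
        using j by (auto simp: orth_compl_def cinner_simps cinner_eq_0_commute[of "u 1 j"])
    qed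
    moreover have "norm (w 1 j) = 1"
      using R.gg[OF j(1) j(1)] j False by (simp add: cinner_self_eq_1_iff)
    ultimately show ?thesis
      by simp
  qed
  then have "arccos (2 * (cos (l j))\<^sup>2 - 1) \<le> 2 * curve_length \<gamma>"
    using Gr_curve_angle_le_length[OF \<gamma> gj] by simp
  moreover have "2 * (cos (l j))\<^sup>2 - 1 = cos (2 * l j)"
    by (simp add: cos_double_cos)
  moreover have "arccos (cos (2 * l j)) = 2 * l j"
    \<comment> \<open>Here \<open>le\<close> matters: \<open>arccos\<close> inverts
      \<open>cos\<close> at \<open>2 * l j\<close> only up to pi.\<close>
    using l_nonneg[OF j(1)] le j by (intro arccos_cos) auto
  ultimately show ?thesis
    using j by simp
qed

end

section \<open>Principal vectors and uniqueness\<close>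

lemma orth_proj_onb: "onb m f N \<Longrightarrow> orth_proj N x = fproj m f x"
  by (intro orth_proj_eqI onb_subspace fproj_mem fproj_orth)

lemma bounded_clinear_fproj: "bounded_clinear (fproj m f)"
proof -
  have "bounded_linear (\<lambda>x. \<Sum>i<m. cinner x (f i) *\<^sub>C f i)"
    by (intro bounded_linear_sum
        bounded_linear_compose[OF bounded_bilinear.bounded_linear_left[OF bounded_bilinear_scaleC]
          bounded_linear_cinner_left])
  then show ?thesis
    by (simp add: bounded_clinear_def fproj_def[abs_def] cinner_simps complex_vector.scale_sum_right
        scaleC_scaleC)
qed

lemma cinner_fproj_mem:
  assumes f: "onb m f N" and y: "y \<in> N"
  shows "cinner (fproj m f x) y = cinner x y"
proof -
  have "cinner (x - fproj m f x) y = 0"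
    using fproj_orth[OF f, of x] y by (simp add: orth_compl_def)
  then show ?thesis
    by (simp add: cinner_diff_left)
qed

text \<open>A singular value decomposition of the projection \<open>P\<close> onto \<open>N\<close>,
  restricted to \<open>M\<close>. A maximizer \<open>x\<close> is paired with the direction
  \<open>y\<close> of \<open>P x\<close>; the rest of \<open>M\<close> is orthogonal to
  \<open>y\<close> and the rest of \<open>N\<close> to \<open>x\<close>, so induction applies to the
  two hyperplanes.\<close>

lemma principal_vectors:
  assumes "has_cdim M m" "has_cdim N m"
  obtains e f c where "onb m e M" "onb m f N" "\<And>i. i < m \<Longrightarrow> (0::real) \<le> c i"
    "\<And>i j. i < m \<Longrightarrow> j < m \<Longrightarrow> cinner (e i) (f j) = complex_of_real (c i) * of_bool (i = j)"
  using assms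
proof (induction m arbitrary: M N thesis)
  case 0
  then show ?case
    by (simp add: has_cdim_0 onb_def)
next
  case (Suc m)
  note M = Suc.prems(2) and N = Suc.prems(3)
  obtain f0 where f0: "onb (Suc m) f0 N"
    using has_cdim_onb[OF N] .
  define P where "P = fproj (Suc m) f0"
  have PN: "P z \<in> N" for z
    unfolding P_def by (rule fproj_mem[OF f0])
  have P: "cinner (P z) y = cinner z y" if "y \<in> N" for z y
    unfolding P_def by (rule cinner_fproj_mem[OF f0 that])
  obtain x where x: "x \<in> M" "norm x = 1" and max: "\<And>y. y \<in> M \<Longrightarrow> norm (P y) \<le> norm (P x) * norm y"
    and ort: "\<And>y. y \<in> M \<Longrightarrow> cinner y x = 0 \<Longrightarrow> cinner (P x) (P y) = 0"
    by (rule maximal_vector[OF M bounded_clinear_fproj[of "Suc m" f0], folded P_def]) (rule that)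
  \<comment> \<open>If \<open>P x = 0\<close>, maximality makes \<open>P\<close> vanish on all of
    \<open>M\<close>, and any unit vector of \<open>N\<close> can be paired with
    \<open>x\<close>.\<close>
  obtain y where y: "y \<in> N" "norm y = 1" and Px: "P x = norm (P x) *\<^sub>R y"
  proof (cases "P x = 0")
    case True
    then show thesis
      using has_cdim_Suc_unit[OF N] that by auto
  next
    case False
    then show thesis
      using complex_vector.subspace_scale[OF has_cdim_subspace[OF N] PN, of "1 / norm (P x)" x]
      by (intro that[of "(1 / norm (P x)) *\<^sub>R P x"]) (simp_all add: scaleR_scaleC norm_divide)
  qed
  have xy: "cinner x y = norm (P x)"
    using P[OF y(1), of x] y by (subst (asm) Px) (simp add: cinner_simps cinner_self)
  have xN: "cinner x z = 0" if "z \<in> N" "cinner z y = 0" for z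
    using P[OF that(1), of x] that(2) cinner_eq_0_commute[of z y]
    by (subst (asm) Px) (simp add: cinner_simps)
  have My: "cinner z y = 0" if z: "z \<in> M" "cinner z x = 0" for z
  proof (cases "P x = 0")
    case True
    then show ?thesis
      using max[OF z(1)] P[OF y(1), of z] by simp
  next
    case False
    have "cinner (P z) (norm (P x) *\<^sub>R y) = 0"
      using ort[OF z] cinner_eq_0_commute[of "P x" "P z"] by (simp flip: Px)
    then show ?thesis
      using False P[OF y(1), of z] by (simp add: cinner_simps)
  qed
  obtain e f c where e: "onb m e (M \<inter> {z. cinner z x = 0})" and f: "onb m f (N \<inter> {z. cinner z y = 0})"
    and c: "\<And>i. i < m \<Longrightarrow> (0::real) \<le> c i"
    and ef: "\<And>i j. i < m \<Longrightarrow> j < m \<Longrightarrow> cinner (e i) (f j) = complex_of_real (c i) * of_bool (i = j)"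
    using Suc.IH[OF _ has_cdim_hyperplane[OF M x] has_cdim_hyperplane[OF N y]] by blast
  show ?case
  proof (rule Suc.prems(1)[OF onb_extend[OF e x has_cdim_subspace[OF M]]
        onb_extend[OF f y has_cdim_subspace[OF N]], of "c(m := norm (P x))"])
    show "0 \<le> (c(m := norm (P x))) i" if "i < Suc m" for i
      using that c by (auto simp: less_Suc_eq)
    show "cinner ((e(m := x)) i) ((f(m := y)) j) =
        complex_of_real ((c(m := norm (P x))) i) * of_bool (i = j)" if "i < Suc m" "j < Suc m" for i j
      using that ef xy xN[of "f j"] My[of "e i"] onb_mem[OF e, of i] onb_mem[OF f, of j]
      by (auto simp: less_Suc_eq)
  qed
qed

text \<open>The angles are the principal angles \<open>arccos (c i)\<close>, and \<open>g i\<close>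
  is the normalized part of \<open>f i\<close> orthogonal to \<open>e i\<close>; turning
  \<open>e i\<close> by \<open>l i\<close> towards \<open>g i\<close> ends at
  \<open>f i\<close>.\<close>

lemma frame_exists:
  fixes M N :: "'h::chilbert_space set"
  assumes "has_cdim N m" "has_cdim M m"
  obtains e g l where "frame m e g l" "onb m e N" "\<And>i. i < m \<Longrightarrow> l i \<le> pi / 2"
    "onb m (rot_e e g l 1) M"
proof -
  obtain e f c where e: "onb m e N" and f: "onb m f M" and c0: "\<And>i. i < m \<Longrightarrow> (0::real) \<le> c i"
    and ef: "\<And>i j. i < m \<Longrightarrow> j < m \<Longrightarrow> cinner (e i) (f j) = complex_of_real (c i) * of_bool (i = j)"
    using principal_vectors[OF assms] by blast
  have fe: "cinner (f i) (e j) = complex_of_real (c i) * of_bool (i = j)" if "i < m" "j < m" for i j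
    using ef[OF that(2,1)] cinner_commute[of "f i" "e j"] by auto
  have c1: "c i \<le> 1" if "i < m" for i
    using norm_cinner_le[of "e i" "f i"] ef[OF that that] onb_norm[OF e that] onb_norm[OF f that] by simp
  define l where "l i = arccos (c i)" for i
  \<comment> \<open>For \<open>l i = 0\<close> the division by \<open>sin 0\<close> yields 0, the
    convention for degenerate planes.\<close>
  define g where "g i = (1 / sin (l i)) *\<^sub>R (f i - c i *\<^sub>R e i)" for i
  have cos_l: "cos (l i) = c i" and l: "0 \<le> l i" "l i \<le> pi / 2" if "i < m" for i
    using c0[OF that] c1[OF that] arccos_lbound[of "c i"] arccos_le_pi2[of "c i"] by (simp_all add: l_def)
  have sin_l: "sin (l i) = 0 \<longleftrightarrow> l i = 0" if "i < m" for i
    using l[OF that] sin_gt_zero[of "l i"] pi_gt_zero by force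
  have fr: "frame m e g l"
  proof
    fix i j assume ij: "i < m" "j < m"
    show "cinner (e i) (e j) = of_bool (i = j)"
      by (rule onb_cinner[OF e ij])
    show "cinner (e i) (g j) = 0"
      using ij by (auto simp: g_def cinner_simps ef onb_cinner[OF e])
    have "complex_of_real (sin (l i) * sin (l i)) = 1 - complex_of_real (c i) * c i"
      using sin_squared_eq[of "l i"] ij by (simp add: cos_l power2_eq_square flip: of_real_mult)
    then show "cinner (g i) (g j) = of_bool (i = j \<and> l i \<noteq> 0)"
      using ij sin_l[OF ij(1)]
      by (auto simp: g_def cinner_simps ef fe onb_cinner[OF e] onb_cinner[OF f] field_simps)
  qed (rule l)
  have "rot_e e g l 1 i = f i" if i: "i < m" for i
  proof (cases "l i = 0")
    case True
    then have "c i = 1"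
      using cos_l[OF i] by simp
    then have "cinner (f i - e i) (f i - e i) = 0"
      using i by (simp add: cinner_simps ef fe onb_cinner[OF e] onb_cinner[OF f])
    then show ?thesis
      using True by (simp add: rot_e_def)
  next
    case False
    then show ?thesis
      using cos_l[OF i] sin_l[OF i] by (simp add: rot_e_def g_def)
  qed
  then have "onb m (rot_e e g l 1) M"
    using f by (simp add: onb_def)
  then show thesis
    using that fr e l(2) by blast
qed

text \<open>Both descriptions of \<open>\<delta>\<close> are kept: the rotated frame serves to
  compute the length, the operator to prove uniqueness.\<close>

lemma geodesic_normal_form:
  assumes N: "has_cdim N m" and \<delta>: "geodesic_joining (orth_compl N) T \<delta>"
  obtains e g l where "frame m e g l" "onb m e N" "T = orth_compl (rot_e e g l 1 ` {..<m})"
    "\<And>t. t \<in> {0..1} \<Longrightarrow>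
      \<delta> t = op_exp (\<lambda>x. (\<i> * complex_of_real t) *\<^sub>C frame.op m e g l x) ` orth_compl N"
    "\<And>t. t \<in> {0..1} \<Longrightarrow> \<delta> t = orth_compl (rot_e e g l t ` {..<m})"
proof -
  obtain A where A: "bounded_clinear A" "selfadjoint A" "codiagonal (orth_compl N) A"
    and \<delta>': "\<And>t. t \<in> {0..1} \<Longrightarrow>
      \<delta> t = op_exp (\<lambda>x. (\<i> * complex_of_real t) *\<^sub>C A x) ` orth_compl N"
    and T: "op_exp (\<lambda>x. \<i> *\<^sub>C A x) ` orth_compl N = T"
    using \<delta> unfolding geodesic_joining_def by blast
  obtain e g l where fr: "frame m e g l" and e: "onb m e N" and op: "A = frame.op m e g l"
    using codiagonal_normal_form[OF N A] .
  interpret frame m e g l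
    by (rule fr)
  have N': "orth_compl N = orth_compl (e ` {..<m})"
    using e orth_compl_span[of "e ` {..<m}"] by (simp add: onb_def)
  show thesis
  proof (rule that[OF fr e])
    show "T = path 1"
      using op_exp_op_image[of 1] T by (simp add: op N')
    show "\<delta> t = op_exp (\<lambda>x. (\<i> * complex_of_real t) *\<^sub>C op x) ` orth_compl N"
      "\<delta> t = path t" if "t \<in> {0..1}" for t
      using op_exp_op_image[of t] \<delta>'[OF that] by (simp_all add: op N')
  qed
qed

section \<open>Minimality of rotations, and the generator recovered from the projection onto the end
  space\<close>

context frame
begin

lemma path_minimal:
  assumes "max_angle \<le> pi / 2"
  shows "path \<in> minimal_geodesics (path 0) (path 1)"
  unfolding minimal_geodesics_def
  using geodesic_path[of path] max_angle_le_length[OF _ assms] curve_length_path[of path] by simp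

text \<open>The projection of \<open>e i\<close> is \<open>cos (l i)\<close> times
  \<open>u 1 i\<close>. Solving for \<open>g i\<close> is possible below a right angle and gives the
  generator; the part in the span of the \<open>e j\<close> shows that \<open>e i\<close> is an
  eigenvector of the compression.\<close>

lemma gen_e_proj:
  assumes i: "i < m" and li: "l i < pi / 2"
  defines "P \<equiv> orth_proj (complex_vector.span (u 1 ` {..<m}))"
  shows "gen (e i) = (l i / (cos (l i) * sin (l i))) *\<^sub>R (P (e i) - (cos (l i))\<^sup>2 *\<^sub>R e i)"
    and "z \<in> complex_vector.span (e ` {..<m}) \<Longrightarrow> cinner (P (e i)) z = (cos (l i))\<^sup>2 * cinner (e i) z"
proof -
  have "P (e i) = (\<Sum>j\<in>{i}. cos (l j) *\<^sub>R u 1 j)"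
    unfolding P_def orth_proj_onb[OF onb_u] fproj_def using i
    by (intro sum.mono_neutral_cong_right) (auto simp: rot_e_def cinner_simps ee eg scaleR_scaleC)
  then have P: "P (e i) = (cos (l i))\<^sup>2 *\<^sub>R e i + (cos (l i) * sin (l i)) *\<^sub>R g i"
    by (simp add: rot_e_def scaleR_add_right power2_eq_square)
  have "cos (l i) > 0"
    using li l_nonneg[OF i] pi_gt_zero by (intro cos_gt_zero_pi) linarith+
  moreover have "sin (l i) > 0" if "l i \<noteq> 0"
    using that li l_nonneg[OF i] by (intro sin_gt_zero2) auto
  \<comment> \<open>For \<open>l i = 0\<close> the quotient is 0 by division by zero, in agreement
    with \<open>gen (e i) = 0\<close>.\<close>
  ultimately show "gen (e i) = (l i / (cos (l i) * sin (l i))) *\<^sub>R (P (e i) - (cos (l i))\<^sup>2 *\<^sub>R e i)"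
    unfolding P gen_e[OF i] by (cases "l i = 0") auto
  show "cinner (P (e i)) z = (cos (l i))\<^sup>2 * cinner (e i) z" if "z \<in> complex_vector.span (e ` {..<m})"
  proof -
    have "g i \<in> orth_compl (e ` {..<m})"
      using i by (auto simp: orth_compl_def ge)
    then have "cinner (g i) z = 0"
      using that orth_compl_span unfolding orth_compl_def by blast
    then show ?thesis
      unfolding P by (simp add: cinner_simps)
  qed
qed

end

text \<open>
  The squared cosines of the angles are the eigenvalues of the compression of the projection onto
  \<open>M\<close> to \<open>N\<close>, and below \<open>pi / 2\<close> the generator is a function of this compression.
\<close>

lemma frame_op_unique:
  assumes F: "frame m e g l" "frame m e' g' l'" and N: "onb m e N" "onb m e' N"
    and M: "onb m (rot_e e g l 1) M" "onb m (rot_e e' g' l' 1) M"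
    and l: "\<And>i. i < m \<Longrightarrow> l i < pi / 2" "\<And>i. i < m \<Longrightarrow> l' i < pi / 2"
  shows "frame.op m e g l = frame.op m e' g' l'"
proof -
  interpret F: frame m e g l
    by (rule F)
  interpret F': frame m e' g' l'
    by (rule F)
  define P where "P = orth_proj M"
  have spM: "complex_vector.span (rot_e e g l 1 ` {..<m}) = M"
    "complex_vector.span (rot_e e' g' l' 1 ` {..<m}) = M"
    and spN: "complex_vector.span (e ` {..<m}) = N" "complex_vector.span (e' ` {..<m}) = N"
    using M N by (simp_all add: onb_def)
  have P: "P = fproj m (rot_e e g l 1)"
    by (auto simp: P_def orth_proj_onb[OF M(1)])
  interpret P: bounded_linear P
    using bounded_clinear_fproj[of m "rot_e e g l 1"] by (simp add: P bounded_clinear_def)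
  have PC: "P (c *\<^sub>C x) = c *\<^sub>C P x" for c x
    using bounded_clinear_fproj[of m "rot_e e g l 1"] by (simp add: P bounded_clinear_def)
  have P_sym: "cinner (P x) y = cinner x (P y)" for x y
  proof -
    have "cinner (P x) (P y) = cinner x (P y)" "cinner (P y) (P x) = cinner y (P x)"
      unfolding P by (rule cinner_fproj_mem[OF M(1) fproj_mem[OF M(1)]])+
    then show ?thesis
      by (metis cinner_commute)
  qed
  interpret G': bounded_linear "rot_gen m e' g' l'"
    by (rule F'.bounded_linear_gen)
  have gen_eq: "rot_gen m e g l (e i) = rot_gen m e' g' l' (e i)" if i: "i < m" for i
  proof -
    define k where "k z = z / (cos z * sin z)" for z :: real
    \<comment> \<open>Eigenvectors of the self-adjoint compression for different eigenvalues are
      orthogonal, and the squared cosine determines an angle in the first quadrant.\<close>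
    have same: "l' j = l i" if j: "j < m" and ne: "cinner (e i) (e' j) \<noteq> 0" for j
    proof -
      have "cinner (P (e i)) (e' j) = (cos (l i))\<^sup>2 * cinner (e i) (e' j)"
        using F.gen_e_proj(2)[OF i l(1)[OF i]] onb_mem[OF N(2) j] by (simp add: spM spN P_def)
      moreover have "cinner (P (e' j)) (e i) = (cos (l' j))\<^sup>2 * cinner (e' j) (e i)"
        using F'.gen_e_proj(2)[OF j l(2)[OF j]] onb_mem[OF N(1) i] by (simp add: spM spN P_def)
      then have "cinner (e i) (P (e' j)) = (cos (l' j))\<^sup>2 * cinner (e i) (e' j)"
        using cinner_commute[of "e i" "P (e' j)"] cinner_commute[of "e i" "e' j"] by simp
      ultimately have "complex_of_real ((cos (l i))\<^sup>2) = complex_of_real ((cos (l' j))\<^sup>2)"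
        using ne by (simp add: P_sym)
      then have "(cos (l i))\<^sup>2 = (cos (l' j))\<^sup>2"
        by (simp only: of_real_eq_iff)
      moreover have "0 \<le> cos (l i)" "0 \<le> cos (l' j)"
        using l(1)[OF i] l(2)[OF j] F.l_nonneg[OF i] F'.l_nonneg[OF j]
        by (auto intro!: cos_ge_zero)
      ultimately have "cos (l i) = cos (l' j)"
        by simp
      then show ?thesis
        using l(1)[OF i] l(2)[OF j] F.l_nonneg[OF i] F'.l_nonneg[OF j] cos_inj_pi[of "l i" "l' j"] by simp
    qed
    have ei: "e i = (\<Sum>j<m. cinner (e i) (e' j) *\<^sub>C e' j)"
      using fproj_id[OF N(2) onb_mem[OF N(1) i]] by (simp add: fproj_def)
    have "rot_gen m e' g' l' (e i) = (\<Sum>j<m. cinner (e i) (e' j) *\<^sub>C rot_gen m e' g' l' (e' j))"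
      by (subst ei) (simp add: G'.sum F'.gen_scaleC)
    \<comment> \<open>By \<open>same\<close>, every nonzero term has \<open>l' j = l i\<close>, so
      the coefficients depending on \<open>j\<close> become constant and the expansion of
      \<open>e i\<close> can be reassembled.\<close>
    also have "\<dots> = (\<Sum>j<m. k (l i) *\<^sub>R (P (cinner (e i) (e' j) *\<^sub>C e' j) -
        (cos (l i))\<^sup>2 *\<^sub>R (cinner (e i) (e' j) *\<^sub>C e' j)))"
    proof (rule sum.cong[OF refl])
      fix j assume "j \<in> {..<m}"
      then have j: "j < m"
        by simp
      show "cinner (e i) (e' j) *\<^sub>C rot_gen m e' g' l' (e' j) = k (l i) *\<^sub>R
          (P (cinner (e i) (e' j) *\<^sub>C e' j) - (cos (l i))\<^sup>2 *\<^sub>R (cinner (e i) (e' j) *\<^sub>C e' j))"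
      proof (cases "cinner (e i) (e' j) = 0")
        case False
        then show ?thesis
          using F'.gen_e_proj(1)[OF j l(2)[OF j]] same[OF j]
          by (simp add: spM PC k_def P_def[symmetric] scaleC_scaleR
              complex_vector.scale_right_diff_distrib)
      qed (simp add: P.zero)
    qed
    also have "\<dots> = k (l i) *\<^sub>R (P (\<Sum>j<m. cinner (e i) (e' j) *\<^sub>C e' j) -
        (cos (l i))\<^sup>2 *\<^sub>R (\<Sum>j<m. cinner (e i) (e' j) *\<^sub>C e' j))"
      by (simp add: P.sum scaleR_sum_right sum_subtractf scaleR_diff_right)
    also have "\<dots> = k (l i) *\<^sub>R (P (e i) - (cos (l i))\<^sup>2 *\<^sub>R e i)"
      by (simp flip: ei)
    also have "\<dots> = rot_gen m e g l (e i)"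
      using F.gen_e_proj(1)[OF i l(1)[OF i]] by (simp add: spM k_def P_def)
    finally show ?thesis
      by simp
  qed
  have "codiagonal (orth_compl N) F.op" "codiagonal (orth_compl N) F'.op"
    using F.op_codiagonal F'.op_codiagonal orth_compl_span[of "e ` {..<m}"]
      orth_compl_span[of "e' ` {..<m}"] by (simp_all add: spN)
  then show ?thesis
    by (intro codiagonal_eqI[OF N(1)] F.op_bounded_clinear F.op_selfadjoint
        F'.op_bounded_clinear F'.op_selfadjoint) (simp_all add: F.op_def F'.op_def gen_eq)
qed

section \<open>Minimal geodesics\<close>

text \<open>A geodesic is unconstrained outside \<open>{0..1}\<close>, so it is never unique as a
  function; passing to classes removes this freedom too.\<close>

lemma reparam_image_cong:
  assumes "\<And>t. t \<in> {0..1} \<Longrightarrow> \<gamma> t = \<delta> t"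
  shows "reparam `` {\<gamma>} = reparam `` {\<delta>}"
proof -
  have "(\<gamma>, \<eta>) \<in> reparam \<longleftrightarrow> (\<delta>, \<eta>) \<in> reparam" for \<eta>
  proof -
    have "(\<forall>t\<in>{0..1}. \<eta> t = \<gamma> (\<phi> t)) \<longleftrightarrow> (\<forall>t\<in>{0..1}. \<eta> t = \<delta> (\<phi> t))"
      if "\<phi> ` {0..1} = {0..1}" for \<phi> :: "real \<Rightarrow> real"
      using that assms by (metis image_eqI)
    then show ?thesis
      unfolding reparam_def by (simp cong: conj_cong)
  qed
  then show ?thesis
    by auto
qed

lemma reparam_refl: "\<gamma> \<in> reparam `` {\<gamma>}"
  unfolding reparam_def by (auto intro!: exI[of _ "\<lambda>t. t"] simp: strict_mono_on_def)

text \<open>The bound on the angles is a consequence of minimality: the length of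
  \<open>\<delta>\<close> is its largest angle and cannot exceed that of the rotation through the
  principal angles.\<close>

lemma minimal_normal_form:
  fixes M N :: "'h::chilbert_space set"
  assumes N: "has_cdim N m" and M: "has_cdim M m"
    and \<delta>: "\<delta> \<in> minimal_geodesics (orth_compl N) (orth_compl M)"
  obtains e g l where "frame m e g l" "onb m e N" "onb m (rot_e e g l 1) M"
    "\<And>i. i < m \<Longrightarrow> l i \<le> pi / 2"
    "\<And>t. t \<in> {0..1} \<Longrightarrow>
      \<delta> t = op_exp (\<lambda>x. (\<i> * complex_of_real t) *\<^sub>C frame.op m e g l x) ` orth_compl N"
proof -
  have geo: "geodesic_joining (orth_compl N) (orth_compl M) \<delta>"
    using \<delta> by (simp add: minimal_geodesics_def)
  obtain e0 g0 l0 where F0: "frame m e0 g0 l0" and e0: "onb m e0 N" and l0: "\<And>i. i < m \<Longrightarrow> l0 i \<le> pi / 2"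
    and M0: "onb m (rot_e e0 g0 l0 1) M"
    by (rule frame_exists[OF N M]) (rule that)
  interpret F0: frame m e0 g0 l0
    by (rule F0)
  obtain e g l where F: "frame m e g l" and e: "onb m e N"
    and T: "orth_compl M = orth_compl (rot_e e g l 1 ` {..<m})"
    and \<delta>op: "\<And>t. t \<in> {0..1} \<Longrightarrow>
      \<delta> t = op_exp (\<lambda>x. (\<i> * complex_of_real t) *\<^sub>C frame.op m e g l x) ` orth_compl N"
    and \<delta>path: "\<And>t. t \<in> {0..1} \<Longrightarrow> \<delta> t = orth_compl (rot_e e g l t ` {..<m})"
    by (rule geodesic_normal_form[OF N geo]) (rule that)
  interpret F: frame m e g l
    by (rule F)
  have ends: "F0.path 0 = orth_compl N" "F0.path 1 = orth_compl M"
    using e0 M0 orth_compl_span[of "e0 ` {..<m}"] orth_compl_span[of "rot_e e0 g0 l0 1 ` {..<m}"]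
    by (simp_all add: F0.u_0 onb_def)
  have "F.max_angle \<le> F0.max_angle"
    using \<delta> F0.Gr_curve_path F.curve_length_path[of \<delta>, OF \<delta>path] F0.curve_length_path[of F0.path]
    unfolding minimal_geodesics_def ends by force
  also have "\<dots> \<le> pi / 2"
    using l0 by (intro F0.max_angle_le) auto
  finally have "l i \<le> pi / 2" if "i < m" for i
    using F.max_angle_ge[OF that] by simp
  moreover have "complex_vector.span (rot_e e g l 1 ` {..<m}) = M"
    using T onb_orth_compl_orth_compl[OF M0] onb_orth_compl_orth_compl[OF F.onb_u[of 1]]
    by (simp add: orth_compl_span)
  then have "onb m (rot_e e g l 1) M"
    using F.onb_u[of 1] by simp
  ultimately show thesis
    by (intro that[OF F e _ _ \<delta>op])
qed

section \<open>Right angles and the free phase\<close>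

context frame
begin

lemma cinner_u_1: "i < m \<Longrightarrow> j < m \<Longrightarrow> cinner (e i) (u 1 j) = complex_of_real (cos (l j)) * of_bool (i = j)"
  by (auto simp: rot_e_def cinner_simps ee eg)

text \<open>The bases \<open>e\<close> of \<open>N\<close> and \<open>u 1\<close> of
  \<open>M\<close> have a diagonal matrix of inner products with entries \<open>cos (l j)\<close>; a
  common vector of \<open>N\<close> and the complement of \<open>M\<close> means that this matrix is
  singular.\<close>

lemma right_angle_iff:
  assumes "onb m e N" "onb m (u 1) M" and l: "\<And>i. i < m \<Longrightarrow> l i \<le> pi / 2"
  shows "(\<exists>i<m. l i = pi / 2) \<longleftrightarrow> (\<exists>x. x \<noteq> 0 \<and> x \<in> N \<and> x \<in> orth_compl M)"
proof
  assume "\<exists>i<m. l i = pi / 2"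
  then obtain i where i: "i < m" "l i = pi / 2"
    by blast
  have "cos (l i) = 0"
    unfolding i(2) by (rule cos_pi_half)
  then have "cinner (e i) (u 1 j) = 0" if "j < m" for j
    using cinner_u_1[OF i(1) that] by (cases "i = j") simp_all
  then have "e i \<in> orth_compl M"
    by (simp add: onb_orth_compl[OF assms(2)])
  moreover have "e i \<noteq> 0"
    using ee[OF i(1) i(1)] by auto
  ultimately show "\<exists>x. x \<noteq> 0 \<and> x \<in> N \<and> x \<in> orth_compl M"
    using onb_mem[OF assms(1) i(1)] by blast
next
  assume "\<exists>x. x \<noteq> 0 \<and> x \<in> N \<and> x \<in> orth_compl M"
  then obtain x where x: "x \<noteq> 0" "x \<in> N" "x \<in> orth_compl M"
    by blast
  have x_eq: "x = (\<Sum>i<m. cinner x (e i) *\<^sub>C e i)"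
    using fproj_id[OF assms(1) x(2)] by (simp add: fproj_def)
  have "\<exists>j<m. cinner x (e j) \<noteq> 0"
  proof (rule ccontr)
    assume "\<not> (\<exists>j<m. cinner x (e j) \<noteq> 0)"
    then have "(\<Sum>i<m. cinner x (e i) *\<^sub>C e i) = 0"
      by (intro sum.neutral) auto
    then show False
      using x(1) x_eq by simp
  qed
  then obtain j where j: "j < m" "cinner x (e j) \<noteq> 0"
    by blast
  have "cinner x (u 1 j) = 0"
    using x(3) j(1) by (simp add: onb_orth_compl[OF assms(2)])
  moreover have "cinner x (u 1 j) = (\<Sum>i<m. (cinner x (e i) * complex_of_real (cos (l i))) * of_bool (i = j))"
  proof -
    have "cinner x (u 1 j) = (\<Sum>i<m. cinner x (e i) * cinner (e i) (u 1 j))"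
      by (subst x_eq) (simp add: cinner_simps)
    also have "\<dots> = (\<Sum>i<m. (cinner x (e i) * complex_of_real (cos (l i))) * of_bool (i = j))"
      by (intro sum.cong refl) (auto simp: cinner_u_1[OF _ j(1)])
    finally show ?thesis .
  qed
  ultimately have "cos (l j) = 0"
    using j by (simp add: sum_of_bool_eq[OF j(1)])
  then have "\<not> l j < pi / 2"
    using cos_gt_zero_pi[of "l j"] l_nonneg[OF j(1)] pi_gt_zero by fastforce
  then show "\<exists>i<m. l i = pi / 2"
    using l[OF j(1)] j(1) by (intro exI[of _ j]) simp
qed

lemma frame_rephase:
  assumes "norm z = 1"
  shows "frame m e (g(n := z *\<^sub>C g n)) l"
proof -
  have "z * cnj z = 1" "cnj z * z = 1"
    using assms by (simp_all add: mult.commute[of "cnj z"] flip: complex_norm_square)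
  then show ?thesis
    using ee eg gg l_nonneg by unfold_locales (auto simp: cinner_simps mult.assoc[symmetric])
qed

text \<open>After a right angle the rotated vector is a multiple of \<open>g n\<close> alone, and a
  nonzero factor does not change what is orthogonal to it.\<close>

lemma rephase_end:
  assumes "l n = pi / 2" "norm z = 1"
  shows "orth_compl (rot_e e (g(n := z *\<^sub>C g n)) l 1 ` {..<m}) = path 1"
proof -
  have "cinner x (rot_e e (g(n := z *\<^sub>C g n)) l 1 i) = 0 \<longleftrightarrow> cinner x (u 1 i) = 0" for x i
  proof (cases "i = n")
    case True
    have "cos (l n) = 0" "sin (l n) = 1"
      unfolding assms(1) by (rule cos_pi_half sin_pi_half)+
    moreover have "z \<noteq> 0"
      using assms(2) by auto
    ultimately show ?thesis
      using True by (simp add: rot_e_def cinner_simps)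
  qed (simp add: rot_e_def)
  then show ?thesis
    by (auto simp: orth_compl_def)
qed

text \<open>
  The midpoint of the geodesic for the phase \<open>z\<close> contains \<open>e n - z *\<^sub>C g n\<close>, and this vector lies on
  no geodesic with another phase.
\<close>

lemma rephase_midpoint:
  assumes n: "n < m" "l n = pi / 2" and z: "norm z = 1" "norm z' = 1" and s: "s \<in> {0..1}"
    and eq: "orth_compl (rot_e e (g(n := z *\<^sub>C g n)) l (1/2) ` {..<m}) =
      orth_compl (rot_e e (g(n := z' *\<^sub>C g n)) l s ` {..<m})"
  shows "z = z'"
proof -
  define y where "y = e n - z *\<^sub>C g n"
  have gp: "cinner (g n) (g n) = 1"
    using gg[OF n(1) n(1)] n(2) by simp
  have zz: "z * cnj z = 1" "z' * cnj z' = 1"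
    using z by (simp_all flip: complex_norm_square)
  have y_other: "cinner y (e i) = 0" "cinner y (g i) = 0" if "i < m" "i \<noteq> n" for i
    using that n(1) by (auto simp: y_def cinner_simps ee eg ge gg)
  have y_p: "cinner y (e n) = 1" "cinner y (g n) = - z"
    using n(1) by (auto simp: y_def cinner_simps ee eg ge gp)
  have half: "1/2 * l n = pi / 4"
    using n(2) by simp
  have "cinner y (rot_e e (g(n := z *\<^sub>C g n)) l (1/2) i) = 0" if "i < m" for i
  proof (cases "i = n")
    case True
    then show ?thesis
      using y_p zz unfolding rot_e_def True half cos_45 sin_45
      by (simp add: cinner_simps mult.commute[of "cnj z"])
  next
    case False
    then show ?thesis
      using y_other[OF that] by (simp add: rot_e_def cinner_simps)
  qed
  then have "y \<in> orth_compl (rot_e e (g(n := z *\<^sub>C g n)) l (1/2) ` {..<m})"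
    by (auto simp: orth_compl_def)
  then have "cinner y (rot_e e (g(n := z' *\<^sub>C g n)) l s n) = 0"
    unfolding eq using n(1) by (auto simp: orth_compl_def)
  then have "complex_of_real (cos (s * (pi / 2))) = complex_of_real (sin (s * (pi / 2))) * (z * cnj z')"
    using n(2) y_p by (simp add: rot_e_def cinner_simps mult.commute)
  define c where "c = cos (s * (pi / 2))"
  define d where "d = sin (s * (pi / 2))"
  have cd: "complex_of_real c = complex_of_real d * (z * cnj z')"
    unfolding c_def d_def by fact
  have "0 \<le> s * (pi / 2)" "s * (pi / 2) \<le> pi / 2"
    using s by (auto intro: mult_left_le_one_le)
  then have "0 \<le> c" "0 \<le> d"
    unfolding c_def d_def using pi_gt_zero by (intro cos_ge_zero sin_ge_zero; linarith)+
  \<comment> \<open>Moduli remove the phases: both numbers are nonnegative, so they coincide, and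
    what remains of \<open>cd\<close> is the equality of the phases.\<close>
  moreover have "\<bar>c\<bar> = \<bar>d\<bar>"
    using arg_cong[OF cd, of norm] z by (simp add: norm_mult)
  moreover have "c\<^sup>2 + d\<^sup>2 = 1"
    by (simp add: c_def d_def)
  ultimately have "c = d" "d \<noteq> 0"
    by auto
  then have "z * cnj z' = 1"
    using cd by simp
  then have "z * (cnj z' * z') = z'"
    by (simp flip: mult.assoc)
  then show ?thesis
    using zz(2) by (simp add: mult.commute)
qed

end

text \<open>The hypothesis excludes right angles from every minimal geodesic. Two of them may have
  different frames, yet their operators agree by \<open>frame_op_unique\<close>.\<close>

lemma unique_geodesicI:
  fixes M N :: "'h::chilbert_space set"
  assumes N: "has_cdim N m" and M: "has_cdim M m"
    and trivial: "\<not> (\<exists>x. x \<noteq> 0 \<and> x \<in> N \<and> x \<in> orth_compl M)"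
  shows "unique_geodesic (orth_compl N) (orth_compl M)"
proof -
  let ?Q = "minimal_geodesics (orth_compl N) (orth_compl M)"
  obtain e g l where F: "frame m e g l" and e: "onb m e N" and l: "\<And>i. i < m \<Longrightarrow> l i \<le> pi / 2"
    and u: "onb m (rot_e e g l 1) M"
    by (rule frame_exists[OF N M]) (rule that)
  interpret F: frame m e g l
    by (rule F)
  have "F.path 0 = orth_compl N" "F.path 1 = orth_compl M"
    using e u orth_compl_span[of "e ` {..<m}"] orth_compl_span[of "rot_e e g l 1 ` {..<m}"]
    by (simp_all add: F.u_0 onb_def)
  moreover have "F.max_angle \<le> pi / 2"
    using l by (intro F.max_angle_le) auto
  ultimately have Q: "F.path \<in> ?Q"
    using F.path_minimal by simp
  have "reparam `` {\<gamma>} = reparam `` {\<delta>}" if Q1: "\<gamma> \<in> ?Q" and Q2: "\<delta> \<in> ?Q" for \<gamma> \<delta>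
  proof (rule reparam_image_cong)
    fix t :: real assume t: "t \<in> {0..1}"
    obtain e1 g1 l1 where F1: "frame m e1 g1 l1" "onb m e1 N" "onb m (rot_e e1 g1 l1 1) M"
      and l1: "\<And>i. i < m \<Longrightarrow> l1 i \<le> pi / 2"
      and \<gamma>: "\<And>t. t \<in> {0..1} \<Longrightarrow>
        \<gamma> t = op_exp (\<lambda>x. (\<i> * complex_of_real t) *\<^sub>C frame.op m e1 g1 l1 x) ` orth_compl N"
      by (rule minimal_normal_form[OF N M Q1]) (rule that)
    obtain e2 g2 l2 where F2: "frame m e2 g2 l2" "onb m e2 N" "onb m (rot_e e2 g2 l2 1) M"
      and l2: "\<And>i. i < m \<Longrightarrow> l2 i \<le> pi / 2"
      and \<delta>: "\<And>t. t \<in> {0..1} \<Longrightarrow>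
        \<delta> t = op_exp (\<lambda>x. (\<i> * complex_of_real t) *\<^sub>C frame.op m e2 g2 l2 x) ` orth_compl N"
      by (rule minimal_normal_form[OF N M Q2]) (rule that)
    have "l1 i < pi / 2" "l2 i < pi / 2" if "i < m" for i
      using frame.right_angle_iff[OF F1 l1] frame.right_angle_iff[OF F2 l2] trivial that l1 l2
      by (force simp: order_less_le)+
    then have "frame.op m e1 g1 l1 = frame.op m e2 g2 l2"
      by (intro frame_op_unique[OF F1(1) F2(1) F1(2) F2(2) F1(3) F2(3)])
    then show "\<gamma> t = \<delta> t"
      using \<gamma>[OF t] \<delta>[OF t] by simp
  qed
  then have "?Q // reparam = {reparam `` {F.path}}"
    using Q unfolding quotient_def by blast
  then show ?thesis
    unfolding unique_geodesic_def by simp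
qed

text \<open>Multiplying \<open>g p\<close> in a plane with a right angle by \<open>cis r\<close>
  keeps both ends and the length; injectivity of \<open>cos\<close> up to pi makes the phases for
  \<open>r\<close> in \<open>{0..1}\<close> distinct.\<close>

lemma infinitely_many_geodesicsI:
  fixes M N :: "'h::chilbert_space set"
  assumes N: "has_cdim N m" and M: "has_cdim M m"
    and x: "\<exists>x. x \<noteq> 0 \<and> x \<in> N \<and> x \<in> orth_compl M"
  shows "infinitely_many_geodesics (orth_compl N) (orth_compl M)"
proof -
  let ?Q = "minimal_geodesics (orth_compl N) (orth_compl M)"
  obtain e g l where F: "frame m e g l" and e: "onb m e N" and l: "\<And>i. i < m \<Longrightarrow> l i \<le> pi / 2"
    and u: "onb m (rot_e e g l 1) M"
    by (rule frame_exists[OF N M]) (rule that)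
  interpret F: frame m e g l
    by (rule F)
  obtain p where p: "p < m" "l p = pi / 2"
    using F.right_angle_iff[OF e u l] x by blast
  have S: "orth_compl (e ` {..<m}) = orth_compl N" and T: "F.path 1 = orth_compl M"
    using e u orth_compl_span[of "e ` {..<m}"] orth_compl_span[of "rot_e e g l 1 ` {..<m}"]
    by (simp_all add: onb_def)
  define \<gamma> where "\<gamma> r t = orth_compl (rot_e e (g(p := cis r *\<^sub>C g p)) l t ` {..<m})" for r t
  have Q: "\<gamma> r \<in> ?Q" for r
  proof -
    interpret G: frame m e "g(p := cis r *\<^sub>C g p)" l
      by (rule F.frame_rephase) simp
    have "G.path 0 = orth_compl N" "G.path 1 = orth_compl M"
      using F.rephase_end[OF p(2), of "cis r"] S T by (simp_all add: G.u_0)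
    moreover have "G.max_angle \<le> pi / 2"
      using l by (intro G.max_angle_le) auto
    ultimately show ?thesis
      using G.path_minimal by (simp add: \<gamma>_def[abs_def])
  qed
  have "inj_on (\<lambda>r. reparam `` {\<gamma> r}) {0..1}"
  proof (rule inj_onI)
    fix r s :: real assume rs: "r \<in> {0..1}" "s \<in> {0..1}" "reparam `` {\<gamma> r} = reparam `` {\<gamma> s}"
    \<comment> \<open>Only reflexivity is needed: \<open>\<gamma> r\<close> lies in its own class,
      hence in that of \<open>\<gamma> s\<close>.\<close>
    then have "(\<gamma> s, \<gamma> r) \<in> reparam"
      using reparam_refl[of "\<gamma> r"] by auto
    then obtain \<phi> where "\<phi> ` {0..1} = {0..1::real}" "\<forall>t\<in>{0..1}. \<gamma> r t = \<gamma> s (\<phi> t)"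
      unfolding reparam_def by auto
    then have "\<phi> (1/2) \<in> {0..1}" "\<gamma> r (1/2) = \<gamma> s (\<phi> (1/2))"
      by auto
    then have "cis r = cis s"
      using F.rephase_midpoint[OF p, of "cis r" "cis s" "\<phi> (1/2)"] by (simp add: \<gamma>_def)
    then have "cos r = cos s"
      by (simp add: complex_eq_iff)
    then show "r = s"
      using rs pi_gt3 cos_inj_pi[of r s] by simp
  qed
  then have "infinite ((\<lambda>r. reparam `` {\<gamma> r}) ` {0..1})"
    using finite_imageD infinite_Icc[of "0::real" 1] by fastforce
  moreover have "(\<lambda>r. reparam `` {\<gamma> r}) ` {0..1} \<subseteq> ?Q // reparam"
    using Q by (auto intro: quotientI)
  ultimately show ?thesis
    unfolding infinitely_many_geodesics_def using finite_subset by blast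
qed

section \<open>The determinant as a test for a common vector\<close>

lemma gram_det_eq_0_iff:
  fixes v w :: "nat \<Rightarrow> 'h::complex_inner"
  assumes inj: "inj_on v {..<k}" and ind: "complex_vector.independent (v ` {..<k})"
  shows "Determinant.det (mat k k (\<lambda>(i, j). cinner (w i) (v j))) = 0 \<longleftrightarrow>
    (\<exists>x. x \<noteq> 0 \<and> x \<in> complex_vector.span (v ` {..<k}) \<and> x \<in> orth_compl (w ` {..<k}))"
    (is "Determinant.det ?G = 0 \<longleftrightarrow> ?R")
proof -
  have G: "?G \<in> carrier_mat k k"
    by simp
  \<comment> \<open>The columns enter through the conjugate-linear argument, so a vector
    \<open>c\<close> in the kernel of the matrix corresponds to the combination with conjugated
    coefficients.\<close>
  have entry: "vec_index (?G *\<^sub>v c) i = cinner (w i) (\<Sum>j<k. cnj (vec_index c j) *\<^sub>C v j)"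
    if "c \<in> carrier_vec k" "i < k" for c i
    using that by (simp add: scalar_prod_def cinner_simps atLeast0LessThan mult.commute)
  have span: "complex_vector.span (v ` {..<k}) = {\<Sum>j<k. a j *\<^sub>C v j | a. True}"
  proof -
    have "(\<Sum>j<k. a j *\<^sub>C v j) \<in> complex_vector.span (v ` {..<k})" for a
      by (intro complex_vector.span_sum complex_vector.span_scale complex_vector.span_base) auto
    moreover have "\<exists>a. x = (\<Sum>j<k. a j *\<^sub>C v j)" if "x \<in> complex_vector.span (v ` {..<k})" for x
      using that unfolding complex_vector.span_finite[OF finite_imageI[OF finite_lessThan]]
      by (auto simp: sum.reindex[OF inj])
    ultimately show ?thesis
      by blast
  qed
  show ?thesis
  proof
    assume "Determinant.det ?G = 0"
    then obtain c where c: "c \<in> carrier_vec k" "c \<noteq> 0\<^sub>v k" "?G *\<^sub>v c = 0\<^sub>v k"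
      using det_0_iff_vec_prod_zero_field[OF G] by blast
    define x where "x = (\<Sum>j<k. cnj (vec_index c j) *\<^sub>C v j)"
    have "x \<noteq> 0"
    proof
      assume "x = 0"
      \<comment> \<open>Independence concerns the set of the \<open>v j\<close>, so the coefficients
        are transported from indices to vectors by the inverse of \<open>v\<close>.\<close>
      then have sum0: "(\<Sum>y\<in>v ` {..<k}. cnj (vec_index c (the_inv_into {..<k} v y)) *\<^sub>C y) = 0"
        by (simp add: x_def sum.reindex[OF inj] the_inv_into_f_f[OF inj])
      have "vec_index c j = 0" if "j < k" for j
        using complex_vector.independentD[OF ind _ subset_refl sum0, of "v j"] that
        by (simp add: the_inv_into_f_f[OF inj])
      then show False
        using c(1,2) by (auto intro!: eq_vecI)
    qed
    moreover have "cinner (w i) x = 0" if "i < k" for i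
      using entry[OF c(1) that] c(3) that by (simp add: x_def)
    then have "x \<in> orth_compl (w ` {..<k})"
      by (auto simp: orth_compl_def cinner_eq_0_commute[of x])
    moreover have "x \<in> complex_vector.span (v ` {..<k})"
      unfolding span x_def by (intro CollectI exI[of _ "\<lambda>j. cnj (vec_index c j)"]) simp
    ultimately show ?R
      by blast
  next
    assume ?R
    then obtain x a where x: "x \<noteq> 0" "x = (\<Sum>j<k. a j *\<^sub>C v j)" "x \<in> orth_compl (w ` {..<k})"
      unfolding span by blast
    define c where "c = vec k (\<lambda>j. cnj (a j))"
    have c: "c \<in> carrier_vec k"
      by (simp add: c_def)
    have x': "x = (\<Sum>j<k. cnj (vec_index c j) *\<^sub>C v j)"
      by (simp add: x(2) c_def)
    have "?G *\<^sub>v c = 0\<^sub>v k"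
    proof (rule eq_vecI)
      fix i assume "i < dim_vec (0\<^sub>v k)"
      then have i: "i < k"
        by simp
      then have "cinner (w i) x = 0"
        using x(3) by (auto simp: orth_compl_def cinner_eq_0_commute[of x])
      then show "vec_index (?G *\<^sub>v c) i = vec_index (0\<^sub>v k) i"
        using entry[OF c i] i by (simp add: x')
    qed simp
    moreover have "c \<noteq> 0\<^sub>v k"
    proof
      assume "c = 0\<^sub>v k"
      then have "x = 0"
        by (simp add: x')
      with x(1) show False ..
    qed
    ultimately show "Determinant.det ?G = 0"
      using det_0_iff_vec_prod_zero_field[OF G] c by blast
  qed
qed

theorem proposition2p2:
  fixes ev :: "'h::chilbert_space \<Rightarrow> 'x \<Rightarrow> complex"
    and K :: "'x \<Rightarrow> 'h"
    and a b :: "nat \<Rightarrow> 'x"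
    and m k :: nat
  assumes "rkhs ev K"
    and "infinite_cdim TYPE('h)"
    and "inj_on a {1..m}" and "inj_on b {1..k}"
    and "a ` {1..m} \<inter> b ` {1..k} = {}"
    and "inj_on K (a ` {1..m})" and "complex_vector.independent (K ` a ` {1..m})"
    and "inj_on K (b ` {1..k})" and "complex_vector.independent (K ` b ` {1..k})"
  defines "Za \<equiv> zero_subspace ev (a ` {1..m})"
    and "Zb \<equiv> zero_subspace ev (b ` {1..k})"
    and "G \<equiv> mat k k (\<lambda>(i, j). ev (K (b (i + 1))) (a (j + 1)))"
  shows "((\<exists>\<delta>. geodesic_joining Za Zb \<delta>) \<longleftrightarrow> m = k) \<and>
    (k = m \<longrightarrow>
      (unique_geodesic Za Zb \<longleftrightarrow> Determinant.det G \<noteq> 0) \<and>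
      (Determinant.det G = 0 \<longrightarrow> infinitely_many_geodesics Za Zb))"
proof -
  have ev: "ev f w = cinner f (K w)" for f w
    using assms(1) by (simp add: rkhs_def)
  \<comment> \<open>The letters change sides: here \<open>M\<close> is the complement of the
    starting subspace, a role that \<open>N\<close> has in the preceding lemmas.\<close>
  define M where "M = complex_vector.span (K ` a ` {1..m})"
  define N where "N = complex_vector.span (K ` b ` {1..k})"
  have dims: "has_cdim M m" "has_cdim N k"
    unfolding has_cdim_def M_def N_def using assms(3,4,6-9) by (metis card_atLeastAtMost card_image
        diff_Suc_1 finite_atLeastAtMost finite_imageI)+
  have Za: "Za = orth_compl M" and Zb: "Zb = orth_compl N"
    unfolding Za_def Zb_def M_def N_def orth_compl_span
    by (auto simp: zero_subspace_def orth_compl_def ev)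
  have "m = k" if geo: "geodesic_joining Za Zb \<delta>" for \<delta>
  proof -
    obtain e g l where F: "frame m e g l" and T: "Zb = orth_compl (rot_e e g l 1 ` {..<m})"
      using geodesic_normal_form[OF dims(1)] geo unfolding Za by blast
    obtain f where f: "onb k f N"
      using has_cdim_onb[OF dims(2)] .
    interpret frame m e g l
      by (rule F)
    \<comment> \<open>Taking complements at time 1 exhibits \<open>N\<close> as the span of
      \<open>m\<close> orthonormal vectors, while its dimension is \<open>k\<close>.\<close>
    have "N = complex_vector.span (u 1 ` {..<m})"
      using T onb_orth_compl_orth_compl[OF f] onb_orth_compl_orth_compl[OF onb_u[of 1]]
      by (simp add: orth_compl_span Zb)
    then show ?thesis
      using has_cdim_unique[OF onb_has_cdim[OF onb_u[of 1]]] dims(2) by simp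
  qed
  moreover have "\<exists>\<delta>. geodesic_joining Za Zb \<delta>" if "m = k"
  proof -
    obtain e g l where F: "frame m e g l" and e: "onb m e M" and u: "onb m (rot_e e g l 1) N"
      by (rule frame_exists[OF dims(1) dims(2)[folded \<open>m = k\<close>]]) (rule that)
    interpret frame m e g l
      by (rule F)
    have "path 0 = Za" "path 1 = Zb"
      using e u orth_compl_span[of "e ` {..<m}"] orth_compl_span[of "rot_e e g l 1 ` {..<m}"]
      by (simp_all add: u_0 onb_def Za Zb)
    then show ?thesis
      using geodesic_path[of path] by auto
  qed
  moreover have "(unique_geodesic Za Zb \<longleftrightarrow> Determinant.det G \<noteq> 0) \<and>
      (Determinant.det G = 0 \<longrightarrow> infinitely_many_geodesics Za Zb)" if km: "k = m"
  proof -
    \<comment> \<open>Matrix indices start at 0, the points are numbered from 1.\<close>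
    have shift: "(\<lambda>j. c (j + 1)) ` {..<k} = c ` {1..k}" for c :: "nat \<Rightarrow> 'x"
    proof -
      have "{1..k} = (\<lambda>j. j + 1) ` {..<k}"
        by (simp add: image_Suc_lessThan)
      then show ?thesis
        by (simp add: image_image)
    qed
    have imgs: "(\<lambda>j. K (a (j + 1))) ` {..<k} = K ` a ` {1..m}" "(\<lambda>j. K (b (j + 1))) ` {..<k} = K ` b ` {1..k}"
      using shift[of a] shift[of b] km by (metis image_image)+
    have "inj_on (\<lambda>j. K (a (j + 1))) {..<k}"
    proof (rule inj_onI)
      fix i j assume ij: "i \<in> {..<k}" "j \<in> {..<k}" "K (a (i + 1)) = K (a (j + 1))"
      then have "i + 1 \<in> {1..m}" "j + 1 \<in> {1..m}"
        using km by auto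
      then show "i = j"
        using inj_onD[OF assms(6) ij(3)] inj_onD[OF assms(3), of "i + 1" "j + 1"] by auto
    qed
    \<comment> \<open>By the reproducing property the entries of \<open>G\<close> are inner products
      of the kernels at \<open>b\<close> with those at \<open>a\<close>, so its kernel describes the
      vectors of \<open>M\<close> orthogonal to \<open>N\<close>.\<close>
    then have "Determinant.det G = 0 \<longleftrightarrow> (\<exists>x. x \<noteq> 0 \<and> x \<in> M \<and> x \<in> orth_compl N)"
      unfolding G_def ev using gram_det_eq_0_iff[of "\<lambda>j. K (a (j + 1))" k "\<lambda>i. K (b (i + 1))"] assms(7)
      unfolding imgs by (simp add: M_def N_def orth_compl_span)
    moreover have "\<not> unique_geodesic Za Zb" if "infinitely_many_geodesics Za Zb"
    proof
      assume "unique_geodesic Za Zb"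
      then obtain c where "minimal_geodesics Za Zb // reparam = {c}"
        unfolding unique_geodesic_def by blast
      then show False
        using that by (simp add: infinitely_many_geodesics_def)
    qed
    ultimately show ?thesis
      using unique_geodesicI[of M m N] infinitely_many_geodesicsI[of M m N] dims km
      unfolding Za Zb by blast
  qed
  ultimately show ?thesis
    by blast
qed

end
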